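(* Let $a,b,m,s$ be integers with $a\ge b\ge 0$, $m\ge b$, $m\ge 2$ and $s\ge 1$. Let $P_1,\ldots,P_s$ be points in general position in $\mathbb{P}^1\times\mathbb{P}^1$ (over $\mathbb{C}$) and let $\mathbb{X}=mP_1+\cdots+mP_s\subset\mathbb{P}^1\times\mathbb{P}^1$ be the scheme of fat points of multiplicity $m$ supported at them. Then $$\mathrm{HF}_{\mathbb{X}}(a,b)=\min\left\{(a+1)(b+1),\ s\binom{m+1}{2}-s\binom{m-b}{2}\right\},$$ except if $s=2k+1$ for some integer $k\ge 0$ and $a=bk+c+s(m-b)$ for some $c\in\{0,\ldots,b-2\}$, in which case $$\mathrm{HF}_{\mathbb{X}}(a,b)=(a+1)(b+1)-\binom{c+2}{2}.$$
   Context: Let $S=\mathbb{C}[x_0,x_1;y_0,y_1]=\bigoplus_{i,j}S_{(i,j)}$ be the bi-graded coordinate ring of $\mathbb{P}^1\times\mathbb{P}^1$, where $S_{(i,j)}$ is the space of bi-homogeneous polynomials of bi-degree $(i,j)$. For points $P_1,\ldots,P_s\in\mathbb{P}^1\times\mathbb{P}^1$ with bi-homogeneous prime ideals $\wp_1,\ldots,\wp_s\subset S$, the scheme $\mathbb{X}=mP_1+\cdots+mP_s$ is defined by the ideal $I_{\mathbb{X}}=\wp_1^m\cap\cdots\cap\wp_s^m$, and $\mathrm{HF}_{\mathbb{X}}(a,b)=\dim_{\mathbb{C}}(S/I_{\mathbb{X}})_{(a,b)}=(a+1)(b+1)-\dim_{\mathbb{C}}(I_{\mathbb{X}})_{(a,b)}$.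 "In general position" means that the assertion holds for all $(P_1,\ldots,P_s)$ in some nonempty Zariski open subset of $(\mathbb{P}^1\times\mathbb{P}^1)^s$ (which may depend on $a,b,m,s$). Convention: $\binom{i}{j}=0$ if $i<j$. *)

theory Defs
  imports Complex_Main "HOL-Library.Poly_Mapping"
begin

section \<open>Polynomials\<close>

text \<open>Polynomials are finitely supported maps from exponent vectors to complex coefficients; the
  library makes them a commutative ring under convolution.\<close>

type_synonym 'v cpoly = "('v \<Rightarrow>\<^sub>0 nat) \<Rightarrow>\<^sub>0 complex"

definition poly_eval :: "('v \<Rightarrow> complex) \<Rightarrow> 'v cpoly \<Rightarrow> complex" where
  "poly_eval u f = (\<Sum>t\<in>Poly_Mapping.keys f.
     Poly_Mapping.lookup f t * (\<Prod>v\<in>Poly_Mapping.keys t. u v ^ Poly_Mapping.lookup t v))"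

definition poly_scale :: "complex \<Rightarrow> 'v cpoly \<Rightarrow> 'v cpoly" where
  "poly_scale c f = Poly_Mapping.single 0 c * f"

global_interpretation poly_vs: vector_space poly_scale
proof
  fix a b :: complex and x y :: "'v cpoly"
  show "poly_scale a (x + y) = poly_scale a x + poly_scale a y"
    by (simp add: poly_scale_def algebra_simps)
  show "poly_scale (a + b) x = poly_scale a x + poly_scale b x"
    by (simp add: poly_scale_def algebra_simps single_add)
  show "poly_scale a (poly_scale b x) = poly_scale (a * b) x"
    by (simp add: poly_scale_def mult_single flip: mult.assoc)
  show "poly_scale 1 x = x"
    by (simp add: poly_scale_def)
qed

text \<open>A commutative ring as a module over itself: its submodules are the ideals, and
  \<open>ring_ideal.span A\<close> is the ideal generated by \<open>A\<close>.\<close>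

global_interpretation ring_ideal: module "(*) :: 'a::comm_ring_1 \<Rightarrow> 'a \<Rightarrow> 'a"
  by unfold_locales (simp_all add: algebra_simps)

definition ideal_power :: "'a::comm_ring_1 set \<Rightarrow> nat \<Rightarrow> 'a set" where
  "ideal_power J m = ring_ideal.span {prod_list fs | fs. length fs = m \<and> set fs \<subseteq> J}"


section \<open>The bigraded ring of the product of two projective lines\<close>

datatype coord = X0 | X1 | Y0 | Y1

definition bihom_part :: "nat \<Rightarrow> nat \<Rightarrow> coord cpoly set" where
  "bihom_part i j = {f. \<forall>t\<in>Poly_Mapping.keys f.
     Poly_Mapping.lookup t X0 + Poly_Mapping.lookup t X1 = i \<and>
     Poly_Mapping.lookup t Y0 + Poly_Mapping.lookup t Y1 = j}"

definition proj_eq :: "complex \<times> complex \<Rightarrow> complex \<times> complex \<Rightarrow> bool" where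
  "proj_eq u v \<longleftrightarrow> u \<noteq> (0, 0) \<and> (\<exists>c. c \<noteq> 0 \<and> v = (c * fst u, c * snd u))"

lemma proj_eq_sym: "proj_eq u v \<Longrightarrow> proj_eq v u"
proof -
  assume "proj_eq u v"
  then obtain c where "u \<noteq> (0, 0)" "c \<noteq> 0" "v = (c * fst u, c * snd u)"
    by (auto simp: proj_eq_def)
  then show "proj_eq v u"
    unfolding proj_eq_def by (intro conjI exI[of _ "inverse c"]) (auto simp: prod_eq_iff)
qed

lemma proj_eq_trans: "proj_eq u v \<Longrightarrow> proj_eq v w \<Longrightarrow> proj_eq u w"
proof -
  assume "proj_eq u v" "proj_eq v w"
  then obtain c d where "u \<noteq> (0, 0)" "c \<noteq> 0" "v = (c * fst u, c * snd u)"
    "d \<noteq> 0" "w = (d * fst v, d * snd v)"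
    unfolding proj_eq_def by blast
  then show "proj_eq u w"
    unfolding proj_eq_def by (intro conjI exI[of _ "d * c"]) auto
qed

quotient_type proj_line = "complex \<times> complex" / partial: proj_eq
proof (rule part_equivpI)
  show "\<exists>u. proj_eq u u"
    by (rule exI[of _ "(1, 0)"]) (auto simp: proj_eq_def intro: exI[of _ 1])
  show "symp proj_eq"
    by (rule sympI) (rule proj_eq_sym)
  show "transp proj_eq"
    by (rule transpI) (rule proj_eq_trans)
qed

text \<open>All homogeneous coordinate vectors of a point.\<close>

lift_definition hom_coords :: "proj_line \<Rightarrow> (complex \<times> complex) set" is
  "\<lambda>u. {v. proj_eq u v}"
  by (auto intro: proj_eq_sym proj_eq_trans)

type_synonym biproj = "proj_line \<times> proj_line"

definition bihom_coords :: "biproj \<Rightarrow> (coord \<Rightarrow> complex) set" where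
  "bihom_coords P = {u. (u X0, u X1) \<in> hom_coords (fst P) \<and> (u Y0, u Y1) \<in> hom_coords (snd P)}"

definition point_ideal :: "biproj \<Rightarrow> coord cpoly set" where
  "point_ideal P = ring_ideal.span
     {f. (\<exists>i j. f \<in> bihom_part i j) \<and> (\<forall>u\<in>bihom_coords P. poly_eval u f = 0)}"

definition fat_ideal :: "nat \<Rightarrow> biproj list \<Rightarrow> coord cpoly set" where
  "fat_ideal m Ps = (\<Inter>P\<in>set Ps. ideal_power (point_ideal P) m)"

text \<open>The dimension of the \<open>(a, b)\<close> graded piece of the quotient of the ring by a bihomogeneous
  ideal \<open>J\<close>.\<close>

definition hilbert_function :: "coord cpoly set \<Rightarrow> nat \<Rightarrow> nat \<Rightarrow> int" where
  "hilbert_function J a b =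
     int (poly_vs.dim (bihom_part a b)) - int (poly_vs.dim (J \<inter> bihom_part a b))"


lemma dim_bihom_part: "poly_vs.dim (bihom_part a b) = (a + 1) * (b + 1)"
proof -
  define T where "T = {t :: coord \<Rightarrow>\<^sub>0 nat.
     Poly_Mapping.lookup t X0 + Poly_Mapping.lookup t X1 = a \<and>
     Poly_Mapping.lookup t Y0 + Poly_Mapping.lookup t Y1 = b}"
  define mon where "mon = (\<lambda>t :: coord \<Rightarrow>\<^sub>0 nat. Poly_Mapping.single t (1 :: complex))"
  have UNIV_coord: "(UNIV :: coord set) = {X0, X1, Y0, Y1}"
    using coord.exhaust by auto
  then have fin_coord: "finite A" for A :: "coord set"
    by (metis finite.emptyI finite.insertI rev_finite_subset subset_UNIV)
  have "bij_betw (\<lambda>t. (Poly_Mapping.lookup t X0, Poly_Mapping.lookup t Y0)) T ({..a} \<times> {..b})"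
  proof (rule bij_betw_byWitness[where f' = "\<lambda>(i, j). Poly_Mapping.Abs_poly_mapping
      (\<lambda>v. case v of X0 \<Rightarrow> i | X1 \<Rightarrow> a - i | Y0 \<Rightarrow> j | Y1 \<Rightarrow> b - j)"])
    show "\<forall>t\<in>T. (case (Poly_Mapping.lookup t X0, Poly_Mapping.lookup t Y0) of (i, j) \<Rightarrow>
      Poly_Mapping.Abs_poly_mapping
        (\<lambda>v. case v of X0 \<Rightarrow> i | X1 \<Rightarrow> a - i | Y0 \<Rightarrow> j | Y1 \<Rightarrow> b - j)) = t"
      by (auto simp: T_def fin_coord intro!: poly_mapping_eqI split: coord.split)
  qed (auto simp: T_def fin_coord)
  then have card_T: "card T = (a + 1) * (b + 1)"
    by (simp add: bij_betw_same_card)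
  then have fin_T: "finite T"
    using card.infinite by fastforce
  have inj: "inj_on mon T"
    by (auto simp: mon_def inj_on_def dest: arg_cong[where f = Poly_Mapping.keys])
  have lookup_mon: "Poly_Mapping.lookup (\<Sum>t\<in>T. poly_scale (c t) (mon t)) t0 =
      (if t0 \<in> T then c t0 else 0)" for c t0
  proof -
    have "Poly_Mapping.lookup (\<Sum>t\<in>T. poly_scale (c t) (mon t)) t0 =
        (\<Sum>t\<in>T. if t0 = t then c t else 0)"
      unfolding lookup_sum
      by (intro sum.cong) (auto simp: poly_scale_def mon_def mult_single lookup_single when_def)
    then show ?thesis
      using fin_T by simp
  qed
  have indep: "poly_vs.independent (mon ` T)"
  proof (rule poly_vs.independent_if_scalars_zero)
    fix f x assume z: "(\<Sum>x\<in>mon ` T. poly_scale (f x) x) = 0" and "x \<in> mon ` T"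
    then obtain t where t: "t \<in> T" "x = mon t" by blast
    have "(\<Sum>t\<in>T. poly_scale (f (mon t)) (mon t)) = 0"
      using z by (simp add: sum.reindex[OF inj])
    then show "f x = 0"
      using lookup_mon[of "f \<circ> mon" t] t by simp
  qed (use fin_T in simp)
  have "bihom_part a b = poly_vs.span (mon ` T)"
  proof (intro equalityI subsetI)
    fix f assume f: "f \<in> bihom_part a b"
    have "f = (\<Sum>t\<in>T. poly_scale (Poly_Mapping.lookup f t) (mon t))"
    proof (rule poly_mapping_eqI)
      fix t0
      have "Poly_Mapping.lookup f t0 = 0" if "t0 \<notin> T"
        using f that by (auto simp: bihom_part_def T_def in_keys_iff)
      then show "Poly_Mapping.lookup f t0 =
          Poly_Mapping.lookup (\<Sum>t\<in>T. poly_scale (Poly_Mapping.lookup f t) (mon t)) t0"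
        unfolding lookup_mon by auto
    qed
    moreover have "(\<Sum>t\<in>T. poly_scale (Poly_Mapping.lookup f t) (mon t)) \<in> poly_vs.span (mon ` T)"
      by (intro poly_vs.span_sum poly_vs.span_scale poly_vs.span_base) auto
    ultimately show "f \<in> poly_vs.span (mon ` T)" by simp
  next
    fix f assume "f \<in> poly_vs.span (mon ` T)"
    then obtain c where "f = (\<Sum>x\<in>mon ` T. poly_scale (c x) x)"
      using fin_T by (auto simp: poly_vs.span_finite)
    then have "f = (\<Sum>t\<in>T. poly_scale ((c \<circ> mon) t) (mon t))"
      by (simp add: sum.reindex[OF inj])
    then show "f \<in> bihom_part a b"
      using lookup_mon[of "c \<circ> mon"] by (auto simp: bihom_part_def T_def in_keys_iff split: if_splits)
  qed
  then show ?thesis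
    using indep inj card_T by (simp add: poly_vs.dim_eq_card_independent card_image)
qed

lemma hilbert_function_eq:
  "hilbert_function J a b = int ((a + 1) * (b + 1)) - int (poly_vs.dim (J \<inter> bihom_part a b))"
  by (simp only: hilbert_function_def dim_bihom_part)


section \<open>General position\<close>

text \<open>An \<open>s\<close>-tuple of points is a list of length \<open>s\<close>; the coordinate \<open>v\<close> of its \<open>i\<close>-th entry
  is the variable \<open>(i, v)\<close>.\<close>

definition tuple_coords :: "biproj list \<Rightarrow> (nat \<times> coord \<Rightarrow> complex) set" where
  "tuple_coords Ps = {w. \<forall>i<length Ps. (\<lambda>v. w (i, v)) \<in> bihom_coords (Ps ! i)}"

text \<open>The zero polynomial is multihomogeneous, and the variables of index \<open>\<ge> s\<close> do not occur.\<close>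

definition multihomogeneous :: "nat \<Rightarrow> (nat \<times> coord) cpoly \<Rightarrow> bool" where
  "multihomogeneous s f \<longleftrightarrow> (\<exists>d e. \<forall>t\<in>Poly_Mapping.keys f.
     (\<forall>i<s. Poly_Mapping.lookup t (i, X0) + Poly_Mapping.lookup t (i, X1) = d i \<and>
            Poly_Mapping.lookup t (i, Y0) + Poly_Mapping.lookup t (i, Y1) = e i) \<and>
     (\<forall>i v. s \<le> i \<longrightarrow> Poly_Mapping.lookup t (i, v) = 0))"

definition zariski_closed :: "nat \<Rightarrow> biproj list set \<Rightarrow> bool" where
  "zariski_closed s Z \<longleftrightarrow> (\<exists>F. (\<forall>f\<in>F. multihomogeneous s f) \<and>
     Z = {Ps. length Ps = s \<and> (\<forall>f\<in>F. \<forall>w\<in>tuple_coords Ps. poly_eval w f = 0)})"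

definition zariski_open :: "nat \<Rightarrow> biproj list set \<Rightarrow> bool" where
  "zariski_open s U \<longleftrightarrow> U \<subseteq> {Ps. length Ps = s} \<and> zariski_closed s ({Ps. length Ps = s} - U)"

definition in_general_position :: "nat \<Rightarrow> (biproj list \<Rightarrow> bool) \<Rightarrow> bool" where
  "in_general_position s Q \<longleftrightarrow> (\<exists>U. zariski_open s U \<and> U \<noteq> {} \<and> (\<forall>Ps\<in>U. Q Ps))"

end

theory Submission
  imports Defs "HOL-Computational_Algebra.Polynomial" "Jordan_Normal_Form.Determinant"
begin

text \<open>Why the theorem holds. Place the points in the affine chart, with coordinates
  \<open>(x\<^sub>i, y\<^sub>i)\<close> and distinct \<open>x\<^sub>i\<close>. The forms of degree one in the second variable that pass through
  all \<open>s\<close> points are a free module of rank two over \<open>\<complex>[X]\<close>. Let \<open>F\<close>, \<open>G\<close> be a basis, of degrees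
  \<open>k\<close> and \<open>k'\<close> in the first variable. Their determinant is the polynomial \<open>D\<close> that vanishes simply at
  the \<open>x\<^sub>i\<close>, hence \<open>k + k' = s\<close>; in general position the splitting is balanced: \<open>k = k'\<close> or
  \<open>k' = k + 1\<close>.

  For \<open>b \<le> m\<close> every form of bidegree \<open>(a, b)\<close> with multiplicity \<open>m\<close> at all points is, in exactly one
  way, \<open>D ^ (m - b)\<close> times a combination of the products \<open>F ^ j * G ^ (b - j)\<close> with coefficients
  \<open>h\<^sub>j \<in> \<complex>[X]\<close>. Indeed, express the two fibre coordinates through \<open>F\<close> and \<open>G\<close> by Cramer's rule, at
  the price of the factor \<open>D\<close>. A linear form vanishing at \<open>(x\<^sub>i, y\<^sub>i)\<close> becomes a combination of
  \<open>F\<close> and \<open>G\<close> with coefficients divisible by \<open>X - x\<^sub>i\<close>. So multiplicity \<open>m\<close> at the \<open>i\<close>-th point makes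
  the transformed form divisible by \<open>(X - x\<^sub>i) ^ m\<close> (\<open>vanishing_dvd_subst\<close>), hence by \<open>D ^ m\<close>, and
  inverting the substitution gives the claim (\<open>param_surj\<close>, \<open>param_inj\<close>). The only restriction on the
  \<open>h\<^sub>j\<close> is a bound on their degrees, so the dimension of the space of forms is
  \<open>\<Sum>j\<le>b. max 0 (a + j * k' + (b - j) * k + 1 - s * m)\<close> (\<open>dim_fat_ideal_part\<close>). For
  even \<open>s\<close> all terms are equal and the sum is the expected dimension. For \<open>s = 2 * k + 1\<close> consecutive terms differ by one until they are cut off at zero. The sum is
  unexpectedly large exactly if both negative and positive terms occur before the cut, and then it is
  the triangular number of the exceptional case (\<open>hilbert_function_value\<close>).

  For even \<open>s = 2 * k\<close> a balanced basis exists as soon as polynomials \<open>p\<^sub>0\<close>, \<open>p\<^sub>1\<close> of degree below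
  \<open>k\<close> can be found with arbitrary prescribed values \<open>p\<^sub>0(x\<^sub>i) + y\<^sub>i * p\<^sub>1(x\<^sub>i)\<close>, that is, as soon as a
  certain determinant in the coordinates of the points does not vanish (\<open>even_syzygy_basis\<close>). One
  more point is added by an elementary transformation (\<open>odd_syzygy_basis\<close>). The determinant is
  multihomogeneous and not identically zero. So it is an open condition, satisfied by some tuple, that
  the determinant does not vanish and that the points lie in the chart with distinct first coordinates
  (\<open>generic_tuple_syzygy_basis\<close>).\<close>

text \<open>As a simplification rule, the associativity law of the module structure of a ring over itself
  undoes the rewriting by commutativity and associativity.\<close>

declare ring_ideal.scale_scale [simp del]

section \<open>Evaluation and dehomogenisation as ring homomorphisms\<close>

lemma poly_mapping_expand: "f = (\<Sum>t\<in>Poly_Mapping.keys f. Poly_Mapping.single t (Poly_Mapping.lookup f t))"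
  by (rule poly_mapping_eqI) (auto simp: lookup_sum lookup_single when_def in_keys_iff)

text \<open>The evaluation of a polynomial at a point and its dehomogenisation are both determined by
  multiplicative rules for single terms; the locale derives once that such a rule extends to a
  ring homomorphism.\<close>

locale monomial_substitution =
  fixes \<phi> :: "'k::comm_monoid_add \<Rightarrow> complex \<Rightarrow> 'a::comm_ring_1"
  assumes add: "\<phi> t (c + d) = \<phi> t c + \<phi> t d"
    and mult: "\<phi> (s + t) (c * d) = \<phi> s c * \<phi> t d"
    and one: "\<phi> 0 1 = 1"
begin

definition subst :: "('k \<Rightarrow>\<^sub>0 complex) \<Rightarrow> 'a" where
  "subst f = (\<Sum>t\<in>Poly_Mapping.keys f. \<phi> t (Poly_Mapping.lookup f t))"

lemma zero: "\<phi> t 0 = 0"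
  using add[of t 0 0] by simp

lemma subst_single: "subst (Poly_Mapping.single t c) = \<phi> t c"
  by (cases "c = 0") (auto simp: subst_def zero)

lemma subst_add: "subst (f + g) = subst f + subst g"
  unfolding subst_def by (rule setsum_keys_plus_distrib) (auto simp: zero add)

lemma subst_sum: "subst (sum f A) = (\<Sum>i\<in>A. subst (f i))"
proof (induction A rule: infinite_finite_induct)
  case (insert x A)
  then show ?case by (simp add: subst_add)
qed (auto simp: subst_def)

lemma subst_mult: "subst (f * g) = subst f * subst g"
proof -
  have "f * g = (\<Sum>s\<in>Poly_Mapping.keys f. \<Sum>t\<in>Poly_Mapping.keys g.
      Poly_Mapping.single (s + t) (Poly_Mapping.lookup f s * Poly_Mapping.lookup g t))"
    by (subst (1) poly_mapping_expand[of f], subst (1) poly_mapping_expand[of g])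
      (simp add: sum_product mult_single)
  then show ?thesis
    by (simp add: subst_sum subst_single mult sum_product subst_def[of f] subst_def[of g])
qed

lemma subst_one: "subst 1 = 1"
  using subst_single[of 0 1] by (simp add: one)

lemma subst_hom: "comm_ring_hom subst"
  by unfold_locales (simp_all add: subst_one subst_add subst_mult subst_single[of 0 0, simplified] zero)

end

definition monomial_value :: "('v \<Rightarrow> complex) \<Rightarrow> ('v \<Rightarrow>\<^sub>0 nat) \<Rightarrow> complex" where
  "monomial_value u t = (\<Prod>v\<in>Poly_Mapping.keys t. u v ^ Poly_Mapping.lookup t v)"

lemma monomial_value_superset:
  assumes "finite A" "Poly_Mapping.keys t \<subseteq> A"
  shows "monomial_value u t = (\<Prod>v\<in>A. u v ^ Poly_Mapping.lookup t v)"
  unfolding monomial_value_def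
  by (rule prod.mono_neutral_left) (use assms in \<open>auto simp: in_keys_iff\<close>)

lemma monomial_value_add: "monomial_value u (s + t) = monomial_value u s * monomial_value u t"
proof -
  let ?A = "Poly_Mapping.keys s \<union> Poly_Mapping.keys t"
  have "Poly_Mapping.keys (s + t) \<subseteq> ?A" by (rule keys_add)
  then show ?thesis
    by (simp add: monomial_value_superset[of ?A] lookup_add power_add prod.distrib)
qed

text \<open>The point evaluation \<open>poly_eval u\<close> is the case \<open>monomial_value u\<close>, hence it is
  multiplicative.\<close>

global_interpretation eval: monomial_substitution "\<lambda>t c. c * monomial_value u t"
  rewrites "eval.subst = poly_eval u" for u :: "'v \<Rightarrow> complex"
proof -
  show *: "monomial_substitution (\<lambda>t c. c * monomial_value u t)"
  proof
    show "(c + d) * monomial_value u t = c * monomial_value u t + d * monomial_value u t" for t c d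
      by (rule distrib_right)
    show "c * d * monomial_value u (r + t) = c * monomial_value u r * (d * monomial_value u t)" for r t c d
      by (simp add: monomial_value_add)
    show "1 * monomial_value u 0 = 1"
      by (simp add: monomial_value_def)
  qed
  show "monomial_substitution.subst (\<lambda>t c. c * monomial_value u t) = poly_eval u"
    by (rule ext) (simp only: monomial_substitution.subst_def[OF *] poly_eval_def, simp only: monomial_value_def)
qed

text \<open>Setting \<open>X1 = Y1 = 1\<close> turns a form into a polynomial in \<open>Y0\<close> (outer variable) with coefficients
  in \<open>\<complex>[X0]\<close> (inner variable).\<close>

global_interpretation dehom: monomial_substitution
    "\<lambda>t c. monom (monom c (Poly_Mapping.lookup t X0)) (Poly_Mapping.lookup t Y0)"
  defines dehom = dehom.subst
  by unfold_locales (simp_all add: lookup_add mult_monom add_monom monom_0 flip: one_pCons)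


section \<open>Bihomogeneous forms and polynomials of bounded bidegree\<close>

lemma UNIV_coord: "(UNIV :: coord set) = {X0, X1, Y0, Y1}"
  using coord.exhaust by auto

lemma poly_eval_affine:
  assumes "u X0 = x" "u X1 = 1" "u Y0 = y" "u Y1 = 1"
  shows "poly_eval u f = poly (poly (dehom f) [:y:]) x"
proof -
  have mv: "monomial_value u t = x ^ Poly_Mapping.lookup t X0 * y ^ Poly_Mapping.lookup t Y0" for t
  proof -
    have "monomial_value u t = (\<Prod>v\<in>{X0, X1, Y0, Y1}. u v ^ Poly_Mapping.lookup t v)"
      using subset_UNIV[of "Poly_Mapping.keys t"]
      by (intro monomial_value_superset) (simp_all add: UNIV_coord)
    then show ?thesis by (simp add: assms)
  qed
  have pm: "poly (poly (monom (monom c i) j) [:y:]) x = c * (x ^ i * y ^ j)" for c i j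
    unfolding poly_monom[of "monom c i"] poly_const_pow poly_mult poly_monom by simp
  have "poly_eval u f = (\<Sum>t\<in>Poly_Mapping.keys f. Poly_Mapping.lookup f t * monomial_value u t)"
    by (rule eval.subst_def)
  then show ?thesis
    by (simp only: dehom.subst_def poly_sum mv pm)
qed

definition bimonomial :: "nat \<Rightarrow> nat \<Rightarrow> nat \<Rightarrow> nat \<Rightarrow> coord \<Rightarrow>\<^sub>0 nat" where
  "bimonomial i i' j j' = Poly_Mapping.single X0 i + Poly_Mapping.single X1 i' +
     Poly_Mapping.single Y0 j + Poly_Mapping.single Y1 j'"

lemma lookup_bimonomial [simp]:
  "Poly_Mapping.lookup (bimonomial i i' j j') X0 = i"
  "Poly_Mapping.lookup (bimonomial i i' j j') X1 = i'"
  "Poly_Mapping.lookup (bimonomial i i' j j') Y0 = j"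
  "Poly_Mapping.lookup (bimonomial i i' j j') Y1 = j'"
  by (simp_all add: bimonomial_def lookup_add lookup_single)

lemma bimonomial_lookup:
  "bimonomial (Poly_Mapping.lookup t X0) (Poly_Mapping.lookup t X1)
     (Poly_Mapping.lookup t Y0) (Poly_Mapping.lookup t Y1) = t"
proof (rule poly_mapping_eqI)
  fix v show "Poly_Mapping.lookup (bimonomial (Poly_Mapping.lookup t X0) (Poly_Mapping.lookup t X1)
     (Poly_Mapping.lookup t Y0) (Poly_Mapping.lookup t Y1)) v = Poly_Mapping.lookup t v"
    by (cases v) simp_all
qed

lemma bihom_single:
  "i + i' = a \<Longrightarrow> j + j' = b \<Longrightarrow> Poly_Mapping.single (bimonomial i i' j j') c \<in> bihom_part a b"
  by (auto simp: bihom_part_def)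

lemma bihom_zero: "0 \<in> bihom_part a b"
  by (simp add: bihom_part_def)

lemma bihom_add: "f \<in> bihom_part a b \<Longrightarrow> g \<in> bihom_part a b \<Longrightarrow> f + g \<in> bihom_part a b"
  using keys_add[of f g] by (fastforce simp: bihom_part_def)

lemma bihom_sum: "(\<And>i. i \<in> A \<Longrightarrow> f i \<in> bihom_part a b) \<Longrightarrow> sum f A \<in> bihom_part a b"
  by (induction A rule: infinite_finite_induct) (auto intro: bihom_zero bihom_add)

lemma bihom_mult:
  assumes "f \<in> bihom_part a b" "g \<in> bihom_part c d"
  shows "f * g \<in> bihom_part (a + c) (b + d)"
  unfolding bihom_part_def
proof (intro CollectI ballI)
  fix t assume "t \<in> Poly_Mapping.keys (f * g)"
  then obtain r s where rs: "t = r + s" "r \<in> Poly_Mapping.keys f" "s \<in> Poly_Mapping.keys g"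
    using keys_mult[of f g] by blast
  then have "Poly_Mapping.lookup r X0 + Poly_Mapping.lookup r X1 = a"
     "Poly_Mapping.lookup r Y0 + Poly_Mapping.lookup r Y1 = b"
     "Poly_Mapping.lookup s X0 + Poly_Mapping.lookup s X1 = c"
     "Poly_Mapping.lookup s Y0 + Poly_Mapping.lookup s Y1 = d"
    using assms by (auto simp: bihom_part_def)
  then show "Poly_Mapping.lookup t X0 + Poly_Mapping.lookup t X1 = a + c \<and>
      Poly_Mapping.lookup t Y0 + Poly_Mapping.lookup t Y1 = b + d"
    by (simp add: rs(1) lookup_add)
qed

lemma bihom_power: "f \<in> bihom_part a b \<Longrightarrow> f ^ n \<in> bihom_part (n * a) (n * b)"
proof (induction n)
  case 0
  show ?case by (auto simp: bihom_part_def)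
next
  case (Suc n)
  then show ?case using bihom_mult[of f a b "f ^ n" "n * a" "n * b"] by simp
qed

definition bidegree_le :: "nat \<Rightarrow> nat \<Rightarrow> complex poly poly \<Rightarrow> bool" where
  "bidegree_le a b p \<longleftrightarrow> degree p \<le> b \<and> (\<forall>j. degree (coeff p j) \<le> a)"

definition rehom :: "nat \<Rightarrow> nat \<Rightarrow> complex poly poly \<Rightarrow> coord cpoly" where
  "rehom a b p = (\<Sum>j\<le>b. \<Sum>i\<le>a.
     Poly_Mapping.single (bimonomial i (a - i) j (b - j)) (coeff (coeff p j) i))"

lemma rehom_bihom: "rehom a b p \<in> bihom_part a b"
  unfolding rehom_def by (intro bihom_sum bihom_single) auto

lemma rehom_add: "rehom a b (p + q) = rehom a b p + rehom a b q"
  by (simp add: rehom_def single_add sum.distrib)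

lemma rehom_sum: "rehom a b (sum f A) = (\<Sum>i\<in>A. rehom a b (f i))"
  by (induction A rule: infinite_finite_induct) (simp_all add: rehom_add, simp_all add: rehom_def)

lemma rehom_scale: "rehom a b (smult [:c:] p) = poly_scale c (rehom a b p)"
  by (simp add: rehom_def poly_scale_def sum_distrib_left mult_single)

text \<open>Together with \<open>rehom_dehom\<close> this identifies the forms of bidegree \<open>(a, b)\<close> with the polynomials
  of bidegree at most \<open>(a, b)\<close>.\<close>

lemma dehom_rehom:
  assumes "bidegree_le a b p"
  shows "dehom (rehom a b p) = p"
proof -
  have "dehom (rehom a b p) = (\<Sum>j\<le>b. \<Sum>i\<le>a. monom (monom (coeff (coeff p j) i) i) j)"
    by (simp add: rehom_def dehom.subst_sum dehom.subst_single)
  also have "\<dots> = (\<Sum>j\<le>b. monom (\<Sum>i\<le>a. monom (coeff (coeff p j) i) i) j)"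
    by (simp add: monom_sum)
  also have "\<dots> = p"
    using assms by (simp add: bidegree_le_def poly_as_sum_of_monoms')
  finally show ?thesis .
qed

lemma rehom_dehom:
  assumes f: "f \<in> bihom_part a b"
  shows "rehom a b (dehom f) = f"
proof -
  have "rehom a b (monom (monom (Poly_Mapping.lookup f t) (Poly_Mapping.lookup t X0)) (Poly_Mapping.lookup t Y0)) =
      Poly_Mapping.single t (Poly_Mapping.lookup f t)" if "t \<in> Poly_Mapping.keys f" for t
  proof -
    let ?i = "Poly_Mapping.lookup t X0" and ?j = "Poly_Mapping.lookup t Y0"
    from f that have deg: "?i + Poly_Mapping.lookup t X1 = a" "?j + Poly_Mapping.lookup t Y1 = b"
      by (auto simp: bihom_part_def)
    then have t: "bimonomial ?i (a - ?i) ?j (b - ?j) = t"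
      using bimonomial_lookup[of t] by (metis add_diff_cancel_left')
    have "rehom a b (monom (monom (Poly_Mapping.lookup f t) ?i) ?j) =
        (\<Sum>j\<le>b. \<Sum>i\<le>a. if j = ?j then if i = ?i then Poly_Mapping.single t (Poly_Mapping.lookup f t) else 0 else 0)"
      unfolding rehom_def by (intro sum.cong) (auto simp: t)
    also have "\<dots> = Poly_Mapping.single t (Poly_Mapping.lookup f t)"
    proof -
      have "(\<Sum>i\<le>a. if j = ?j then if i = ?i then c else 0 else 0) = (if j = ?j then c else 0)"
        for c :: "coord cpoly" and j
        using deg by auto
      then show ?thesis using deg by simp
    qed
    finally show ?thesis .
  qed
  then show ?thesis
    by (subst (2) poly_mapping_expand[of f]) (simp add: dehom.subst_def rehom_sum)
qed

lemma bidegree_le_dehom: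
  assumes f: "f \<in> bihom_part a b"
  shows "bidegree_le a b (dehom f)"
proof -
  have "degree (coeff (dehom f) j) \<le> a" for j
    unfolding dehom.subst_def coeff_sum
    using f by (intro degree_sum_le) (auto simp: bihom_part_def coeff_monom intro!: order.trans[OF degree_monom_le])
  moreover have "degree (dehom f) \<le> b"
    unfolding dehom.subst_def
    using f by (intro degree_sum_le) (auto simp: bihom_part_def intro!: order.trans[OF degree_monom_le])
  ultimately show ?thesis by (simp add: bidegree_le_def)
qed

section \<open>Substitution into binary forms\<close>

text \<open>A polynomial \<open>p\<close> of degree at most \<open>b\<close> is read as the binary form
  \<open>\<Sum>j\<le>b. p\<^sub>j * Y0 ^ j * Y1 ^ (b - j)\<close>, into which \<open>u\<close> and \<open>v\<close> are substituted for \<open>Y0\<close> and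
  \<open>Y1\<close>. This expresses linear changes of the homogeneous fibre coordinates without introducing a
  third variable.\<close>

definition binary_subst :: "nat \<Rightarrow> 'a::comm_ring_1 poly \<Rightarrow> 'a poly \<Rightarrow> 'a poly \<Rightarrow> 'a poly" where
  "binary_subst b p u v = (\<Sum>j\<le>b. smult (coeff p j) (u ^ j * v ^ (b - j)))"

lemma binary_subst_add: "binary_subst b (p + q) u v = binary_subst b p u v + binary_subst b q u v"
  by (simp add: binary_subst_def smult_add_left sum.distrib)

lemma binary_subst_zero [simp]: "binary_subst b 0 u v = 0"
  by (simp add: binary_subst_def)

lemma binary_subst_sum: "binary_subst b (sum f A) u v = (\<Sum>i\<in>A. binary_subst b (f i) u v)"
  by (induction A rule: infinite_finite_induct) (simp_all add: binary_subst_add)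

lemma smult_sum_right: "smult c (sum f A) = (\<Sum>i\<in>A. smult c (f i))"
  by (induction A rule: infinite_finite_induct) (simp_all add: smult_add_right)

lemma binary_subst_smult: "binary_subst b (smult c p) u v = smult c (binary_subst b p u v)"
  by (simp add: binary_subst_def smult_sum_right)

lemma binary_subst_pad:
  assumes "degree p \<le> b"
  shows "binary_subst (Suc b) p u v = v * binary_subst b p u v"
proof -
  have "coeff p (Suc b) = 0"
    using assms by (simp add: coeff_eq_0)
  then have "binary_subst (Suc b) p u v = (\<Sum>j\<le>b. smult (coeff p j) (u ^ j * v ^ Suc (b - j)))"
    by (simp add: binary_subst_def Suc_diff_le)
  also have "\<dots> = v * binary_subst b p u v"
    unfolding binary_subst_def sum_distrib_left
    by (intro sum.cong refl) (simp add: mult.left_commute)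
  finally show ?thesis .
qed

lemma binary_subst_pCons_0: "binary_subst (Suc b) (pCons 0 p) u v = u * binary_subst b p u v"
  unfolding binary_subst_def sum.atMost_Suc_shift sum_distrib_left
  by (simp add: mult.assoc)

lemma binary_subst_linear_mult:
  assumes "degree p \<le> b"
  shows "binary_subst (Suc b) ([:c, d:] * p) u v = (smult c v + smult d u) * binary_subst b p u v"
proof -
  have "[:c, d:] * p = smult c p + smult d (pCons 0 p)"
    by (simp add: mult_pCons_left)
  then show ?thesis
    using assms
    by (simp only: binary_subst_add binary_subst_smult binary_subst_pad binary_subst_pCons_0)
      (simp add: distrib_right)
qed

lemma degree_linear_power_le: "degree ([:c, d:] ^ i) \<le> i"
  by (rule order.trans[OF degree_power_le]) simp

lemma binary_subst_linear_power:
  assumes "degree p \<le> b"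
  shows "binary_subst (i + b) ([:c, d:] ^ i * p) u v = (smult c v + smult d u) ^ i * binary_subst b p u v"
proof (induction i)
  case (Suc i)
  have "degree ([:c, d:] ^ i * p) \<le> i + b"
    using assms degree_linear_power_le[of c d i] by (intro order.trans[OF degree_mult_le]) simp
  then show ?case
    using binary_subst_linear_mult[of "[:c, d:] ^ i * p" "i + b" c d u v] Suc
    by (simp only: power_Suc mult.assoc add_Suc)
qed simp

lemma binary_subst_compose:
  "binary_subst b (binary_subst b p [:c, d:] [:c', d':]) u v =
     binary_subst b p (smult c v + smult d u) (smult c' v + smult d' u)"
proof -
  have "binary_subst b ([:c, d:] ^ j * [:c', d':] ^ (b - j)) u v =
      (smult c v + smult d u) ^ j * (smult c' v + smult d' u) ^ (b - j)" if "j \<le> b" for j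
    using binary_subst_linear_power[of "[:c', d':] ^ (b - j)" "b - j" j c d u v]
      binary_subst_linear_power[of 1 0 "b - j" c' d' u v] that degree_linear_power_le[of c' d' "b - j"]
    by (simp add: binary_subst_def)
  then show ?thesis
    by (simp add: binary_subst_sum binary_subst_smult binary_subst_def[of b p])
qed

lemma binary_subst_homogeneous:
  "binary_subst b p (smult d u) (smult d v) = smult (d ^ b) (binary_subst b p u v)"
proof -
  have "smult (coeff p j) (smult d u ^ j * smult d v ^ (b - j)) =
      smult (d ^ b) (smult (coeff p j) (u ^ j * v ^ (b - j)))" if "j \<le> b" for j
    using that power_add[of d j "b - j"] by (simp add: smult_power mult_ac)
  then show ?thesis
    by (simp add: binary_subst_def smult_sum_right del: smult_smult)
qed

text \<open>Links the homogeneous substitution to ordinary composition, the affine case \<open>Y1 = 1\<close>.\<close>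

lemma pcompose_eq_binary_subst:
  assumes "degree p \<le> b"
  shows "pcompose p r = binary_subst b p r 1"
proof -
  have "pcompose p r = (\<Sum>j\<le>degree p. smult (coeff p j) (r ^ j))"
  proof -
    have "pcompose (monom c j) r = smult c (r ^ j)" for c j
      by (induction j) (simp_all add: monom_0 monom_Suc pcompose_pCons)
    then show ?thesis
      by (subst (1) poly_as_sum_of_monoms[of p, symmetric]) (simp add: pcompose_sum)
  qed
  also have "\<dots> = (\<Sum>j\<le>b. smult (coeff p j) (r ^ j))"
    using assms by (intro sum.mono_neutral_left) (auto simp: coeff_eq_0)
  finally show ?thesis by (simp add: binary_subst_def)
qed

section \<open>Degree in the inner variable\<close>

definition xdegree_le :: "nat \<Rightarrow> complex poly poly \<Rightarrow> bool" where
  "xdegree_le a p \<longleftrightarrow> (\<forall>j. degree (coeff p j) \<le> a)"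

lemma xdegree_le_add: "xdegree_le a p \<Longrightarrow> xdegree_le a q \<Longrightarrow> xdegree_le a (p + q)"
  by (auto simp: xdegree_le_def intro: degree_add_le)

lemma xdegree_le_sum: "(\<And>i. i \<in> A \<Longrightarrow> xdegree_le a (f i)) \<Longrightarrow> xdegree_le a (sum f A)"
  by (induction A rule: infinite_finite_induct) (simp_all add: xdegree_le_add, simp_all add: xdegree_le_def)

lemma xdegree_le_mult: "xdegree_le a p \<Longrightarrow> xdegree_le c q \<Longrightarrow> xdegree_le (a + c) (p * q)"
  unfolding xdegree_le_def coeff_mult
  by (intro allI degree_sum_le finite_atMost order.trans[OF degree_mult_le] add_mono) auto

lemma xdegree_le_smult: "degree c \<le> a \<Longrightarrow> xdegree_le e p \<Longrightarrow> xdegree_le (a + e) (smult c p)"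
  unfolding xdegree_le_def by (auto intro!: order.trans[OF degree_mult_le] add_mono)

lemma xdegree_le_power: "xdegree_le a p \<Longrightarrow> xdegree_le (n * a) (p ^ n)"
proof (induction n)
  case (Suc n)
  then show ?case using xdegree_le_mult[of a p "n * a" "p ^ n"] by simp
qed (auto simp: xdegree_le_def)

lemma xdegree_le_linear: "xdegree_le a [:c, d:] \<longleftrightarrow> degree c \<le> a \<and> degree d \<le> a"
  by (auto simp: xdegree_le_def coeff_pCons split: nat.split)

lemma xdegree_le_pcompose:
  assumes "xdegree_le a p" "xdegree_le 0 q"
  shows "xdegree_le a (pcompose p q)"
proof -
  have "xdegree_le a (smult (coeff p j) (q ^ j * 1 ^ (degree p - j)))" for j
    using xdegree_le_smult[of "coeff p j" a 0 "q ^ j"] xdegree_le_power[OF assms(2), of j] assms(1)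
    by (simp add: xdegree_le_def)
  then show ?thesis
    by (simp only: pcompose_eq_binary_subst[OF order.refl] binary_subst_def) (rule xdegree_le_sum)
qed


section \<open>Multiplicity at an affine point\<close>

text \<open>Membership in the \<open>m\<close>-th power of the maximal ideal of the point \<open>(x, y)\<close>: once \<open>y\<close> is moved to the
  origin, this power is generated by the products \<open>(X - x) ^ (m - j) * Y ^ j\<close>, so the condition can be
  read off coefficient by coefficient.\<close>

definition vanishes_to :: "complex \<Rightarrow> complex \<Rightarrow> nat \<Rightarrow> complex poly poly \<Rightarrow> bool" where
  "vanishes_to x y m p \<longleftrightarrow> (\<forall>j. [:-x, 1:] ^ (m - j) dvd coeff (pcompose p [:[:y:], 1:]) j)"

lemma vanishes_to_0: "vanishes_to x y 0 p"
  by (simp add: vanishes_to_def)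

lemma vanishes_to_zero: "vanishes_to x y m 0"
  by (simp add: vanishes_to_def)

lemma vanishes_to_add: "vanishes_to x y m p \<Longrightarrow> vanishes_to x y m q \<Longrightarrow> vanishes_to x y m (p + q)"
  by (auto simp: vanishes_to_def pcompose_add intro: dvd_add)

lemma vanishes_to_sum: "(\<And>i. i \<in> A \<Longrightarrow> vanishes_to x y m (f i)) \<Longrightarrow> vanishes_to x y m (sum f A)"
  by (induction A rule: infinite_finite_induct) (auto intro: vanishes_to_add vanishes_to_zero)

text \<open>The case \<open>n = 0\<close> says that the polynomials vanishing to order \<open>m\<close> form an ideal.\<close>

lemma vanishes_to_mult:
  assumes "vanishes_to x y m p" "vanishes_to x y n q"
  shows "vanishes_to x y (m + n) (p * q)"
  unfolding vanishes_to_def pcompose_mult coeff_mult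
proof (intro allI dvd_sum)
  fix j i :: nat assume "i \<in> {..j}"
  let ?l = "[:-x, 1:]" and ?p = "pcompose p [:[:y:], 1:]" and ?q = "pcompose q [:[:y:], 1:]"
  have "?l ^ (m + n - j) dvd ?l ^ ((m - i) + (n - (j - i)))"
    using \<open>i \<in> {..j}\<close> by (intro le_imp_power_dvd) auto
  also have "?l ^ ((m - i) + (n - (j - i))) dvd coeff ?p i * coeff ?q (j - i)"
    using assms by (auto simp: vanishes_to_def power_add intro: mult_dvd_mono)
  finally show "?l ^ (m + n - j) dvd coeff ?p i * coeff ?q (j - i)" .
qed

lemma vanishes_to_mult_any: "vanishes_to x y m p \<Longrightarrow> vanishes_to x y m (q * p)"
  using vanishes_to_mult[of x y 0 q m p] by (simp add: vanishes_to_0)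

lemma vanishes_to_power: "vanishes_to x y 1 p \<Longrightarrow> vanishes_to x y m (p ^ m)"
  using vanishes_to_mult[of x y 1 p] by (induction m) (auto simp: vanishes_to_0)

lemma vanishes_to_1_iff: "vanishes_to x y 1 p \<longleftrightarrow> poly (poly p [:y:]) x = 0"
proof -
  have "coeff (pcompose p [:[:y:], 1:]) 0 = poly p [:y:]"
    by simp
  moreover have "[:-x, 1:] ^ (1 - j) = 1" if "j > 0" for j
    using that by simp
  ultimately show ?thesis
    unfolding vanishes_to_def poly_eq_0_iff_dvd
    by (metis One_nat_def diff_zero gr0I one_dvd power_one_right)
qed

definition affine_point :: "biproj \<Rightarrow> complex \<Rightarrow> complex \<Rightarrow> bool" where
  "affine_point P x y \<longleftrightarrow> bihom_coords P =
     {u. u X1 \<noteq> 0 \<and> u Y1 \<noteq> 0 \<and> u X0 = x * u X1 \<and> u Y0 = y * u Y1}"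

lemma vanishes_to_point_ideal:
  assumes P: "affine_point P x y" and f: "f \<in> point_ideal P"
  shows "vanishes_to x y 1 (dehom f)"
  using f unfolding point_ideal_def
proof (induction rule: ring_ideal.span_induct_alt)
  case base
  then show ?case by (simp add: dehom.subst_def vanishes_to_zero)
next
  case (step c g h)
  define u where "u = (\<lambda>v. case v of X0 \<Rightarrow> x | X1 \<Rightarrow> 1 | Y0 \<Rightarrow> y | Y1 \<Rightarrow> 1)"
  have "u \<in> bihom_coords P"
    using P by (simp add: affine_point_def u_def)
  with step have "poly_eval u g = 0" by blast
  then have "vanishes_to x y 1 (dehom g)"
    by (subst (asm) poly_eval_affine[where x = x and y = y]) (simp_all add: u_def vanishes_to_1_iff del: One_nat_def)
  with step show ?case
    by (simp add: dehom.subst_add dehom.subst_mult vanishes_to_add vanishes_to_mult_any)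
qed

lemma vanishes_to_ideal_power:
  assumes P: "affine_point P x y" and f: "f \<in> ideal_power (point_ideal P) m"
  shows "vanishes_to x y m (dehom f)"
  using f unfolding ideal_power_def
proof (induction rule: ring_ideal.span_induct_alt)
  case base
  then show ?case by (simp add: dehom.subst_def vanishes_to_zero)
next
  case (step c g h)
  then obtain fs where fs: "g = prod_list fs" "length fs = m" "set fs \<subseteq> point_ideal P" by blast
  from fs(3) have "vanishes_to x y (length fs) (dehom (prod_list fs))"
  proof (induction fs)
    case Nil
    then show ?case by (simp add: vanishes_to_0)
  next
    case (Cons a fs)
    then show ?case
      using vanishes_to_mult[of x y 1 "dehom a" "length fs"] vanishes_to_point_ideal[OF P, of a]
      by (simp add: dehom.subst_mult)
  qed
  with step fs show ?case
    by (simp add: dehom.subst_add dehom.subst_mult vanishes_to_add vanishes_to_mult_any)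
qed

definition fibre_form :: "complex \<Rightarrow> coord cpoly" where
  "fibre_form x = Poly_Mapping.single (bimonomial 1 0 0 0) 1 + Poly_Mapping.single (bimonomial 0 1 0 0) (- x)"

definition section_form :: "complex \<Rightarrow> coord cpoly" where
  "section_form y = Poly_Mapping.single (bimonomial 0 0 1 0) 1 + Poly_Mapping.single (bimonomial 0 0 0 1) (- y)"

lemma monomial_value_bimonomial:
  "monomial_value u (bimonomial i i' j j') = u X0 ^ i * u X1 ^ i' * u Y0 ^ j * u Y1 ^ j'"
  using subset_UNIV[of "Poly_Mapping.keys (bimonomial i i' j j')"]
  by (subst monomial_value_superset[of "{X0, X1, Y0, Y1}"]) (simp_all add: UNIV_coord)

lemma fibre_form_bihom: "fibre_form x \<in> bihom_part 1 0"
  unfolding fibre_form_def by (intro bihom_add bihom_single) auto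

lemma section_form_bihom: "section_form y \<in> bihom_part 0 1"
  unfolding section_form_def by (intro bihom_add bihom_single) auto

lemma dehom_fibre_form: "dehom (fibre_form x) = [:[:- x, 1:]:]"
  by (simp add: fibre_form_def dehom.subst_add dehom.subst_single monom_Suc monom_0)

lemma dehom_section_form: "dehom (section_form y) = [:[:- y:], 1:]"
  by (simp add: section_form_def dehom.subst_add dehom.subst_single monom_Suc monom_0 one_pCons)

lemma fibre_form_point_ideal:
  assumes "affine_point P x y"
  shows "fibre_form x \<in> point_ideal P"
  unfolding point_ideal_def
proof (rule ring_ideal.span_base, intro CollectI conjI ballI)
  fix u assume "u \<in> bihom_coords P"
  with assms show "poly_eval u (fibre_form x) = 0"
    by (simp add: affine_point_def fibre_form_def eval.subst_add eval.subst_single monomial_value_bimonomial)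
qed (use fibre_form_bihom in blast)

lemma section_form_point_ideal:
  assumes "affine_point P x y"
  shows "section_form y \<in> point_ideal P"
  unfolding point_ideal_def
proof (rule ring_ideal.span_base, intro CollectI conjI ballI)
  fix u assume "u \<in> bihom_coords P"
  with assms show "poly_eval u (section_form y) = 0"
    by (simp add: affine_point_def section_form_def eval.subst_add eval.subst_single monomial_value_bimonomial)
qed (use section_form_bihom in blast)

text \<open>Homogenisation does not lose the multiplicity: if \<open>f\<close> dehomogenises to
  \<open>\<Sum>j. (X - x) ^ (m - j) * e\<^sub>j * (Y - y) ^ j\<close>, then homogenising each summand separately exhibits
  \<open>f\<close> as a combination of products of \<open>m\<close> linear forms through the point. The hypothesis
  \<open>b \<le> m\<close> ensures that each \<open>j\<close> in the sum is at most \<open>m\<close>.\<close>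

lemma mem_ideal_power_iff:
  assumes P: "affine_point P x y" and f: "f \<in> bihom_part a b" and bm: "b \<le> m"
  shows "f \<in> ideal_power (point_ideal P) m \<longleftrightarrow> vanishes_to x y m (dehom f)"
proof
  show "f \<in> ideal_power (point_ideal P) m \<Longrightarrow> vanishes_to x y m (dehom f)"
    by (rule vanishes_to_ideal_power[OF P])
next
  assume v: "vanishes_to x y m (dehom f)"
  let ?q = "pcompose (dehom f) [:[:y:], 1:]"
  have deg_f: "degree (dehom f) \<le> b" "\<And>j. degree (coeff (dehom f) j) \<le> a"
    using bidegree_le_dehom[OF f] by (auto simp: bidegree_le_def)
  have deg_q: "degree (coeff ?q j) \<le> a" for j
    using xdegree_le_pcompose[of a "dehom f" "[:[:y:], 1:]"] deg_f(2)
    by (simp add: xdegree_le_def coeff_pCons split: nat.splits)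
  from v have "\<forall>j. \<exists>e. coeff ?q j = [:-x, 1:] ^ (m - j) * e"
    unfolding vanishes_to_def dvd_def .
  then obtain e where e: "\<And>j. coeff ?q j = [:-x, 1:] ^ (m - j) * e j" by metis
  \<comment> \<open>Vanishing coefficients are left out: the degree bound that keeps the homogenised summand in bidegree \<open>(a, b)\<close> is available for nonzero ones.\<close>
  define J where "J = {j. j \<le> b \<and> e j \<noteq> 0}"
  have deg_e: "m - j + degree (e j) \<le> a" if "j \<in> J" for j
    using deg_q[of j] that by (simp add: e J_def degree_mult_eq degree_power_eq)
  define Y where "Y = (Poly_Mapping.single (bimonomial 0 0 0 1) 1 :: coord cpoly)"
  define g where "g j = rehom (a - (m - j)) 0 [:e j:] * Y ^ (b - j)" for j
  define h where "h j = fibre_form x ^ (m - j) * section_form y ^ j" for j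
  have g: "g j \<in> bihom_part (a - (m - j)) (b - j)" for j
    using bihom_mult[OF rehom_bihom bihom_power[of Y 0 1 "b - j"], of "a - (m - j)" 0 "[:e j:]"]
    by (simp add: g_def Y_def bihom_single)
  have h: "h j \<in> bihom_part (m - j) j" for j
    using bihom_mult[OF bihom_power[OF fibre_form_bihom] bihom_power[OF section_form_bihom]]
    by (simp add: h_def)
  have Y: "dehom Y = 1"
    by (simp add: Y_def dehom.subst_single monom_0 one_pCons)
  have gh: "dehom (g j * h j) = smult (coeff ?q j) ([:[:- y:], 1:] ^ j)" if "j \<in> J" for j
  proof -
    interpret dh: comm_ring_hom dehom by (rule dehom.subst_hom)
    have "dehom (rehom (a - (m - j)) 0 [:e j:]) = [:e j:]"
      using deg_e[OF that] by (intro dehom_rehom) (auto simp: bidegree_le_def coeff_pCons split: nat.split)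
    then show ?thesis
      by (simp add: g_def h_def e Y dehom.subst_mult dh.hom_power dehom_fibre_form dehom_section_form
          poly_const_pow mult.commute)
  qed
  \<comment> \<open>Both sides have bidegree \<open>(a, b)\<close> and the same dehomogenisation.\<close>
  have "f = (\<Sum>j\<in>J. g j * h j)"
  proof -
    have "pcompose ?q [:[:- y:], 1:] = dehom f"
      by (simp add: pcompose_pCons flip: pcompose_assoc)
    moreover have "degree ?q \<le> b"
      using deg_f(1) by (simp add: degree_pcompose)
    ultimately have "dehom f = (\<Sum>j\<le>b. smult (coeff ?q j) ([:[:- y:], 1:] ^ j))"
      using pcompose_eq_binary_subst[of ?q b] by (simp add: binary_subst_def)
    also have "\<dots> = (\<Sum>j\<in>J. smult (coeff ?q j) ([:[:- y:], 1:] ^ j))"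
      by (rule sum.mono_neutral_right) (auto simp: J_def e)
    also have "\<dots> = dehom (\<Sum>j\<in>J. g j * h j)"
      by (simp add: gh dehom.subst_sum)
    finally have "rehom a b (dehom f) = rehom a b (dehom (\<Sum>j\<in>J. g j * h j))" by simp
    moreover have "(\<Sum>j\<in>J. g j * h j) \<in> bihom_part a b"
    proof (rule bihom_sum)
      fix j assume j: "j \<in> J"
      then have "a - (m - j) + (m - j) = a" "b - j + j = b"
        using deg_e[OF j] by (auto simp: J_def)
      then show "g j * h j \<in> bihom_part a b"
        using bihom_mult[OF g h, of j j] by simp
    qed
    ultimately show ?thesis using f by (simp add: rehom_dehom)
  qed
  moreover have "h j \<in> ideal_power (point_ideal P) m" if "j \<in> J" for j
    unfolding ideal_power_def
  proof (rule ring_ideal.span_base, intro CollectI exI conjI)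
    show "h j = prod_list (replicate (m - j) (fibre_form x) @ replicate j (section_form y))"
      by (simp add: h_def)
  qed (use that bm fibre_form_point_ideal[OF P] section_form_point_ideal[OF P] in \<open>auto simp: J_def\<close>)
  ultimately show "f \<in> ideal_power (point_ideal P) m"
    unfolding ideal_power_def
    by (auto intro!: ring_ideal.span_sum ring_ideal.span_scale)
qed

section \<open>Divisibility by powers of linear factors\<close>

lemma linear_power_dvd_mult_cancel:
  fixes p q :: "complex poly"
  assumes "[:- a, 1:] ^ m dvd p * q" "poly p a \<noteq> 0"
  shows "[:- a, 1:] ^ m dvd q"
proof (cases "q = 0")
  case False
  have "p * q \<noteq> 0" using False assms(2) by auto
  then show ?thesis
    using assms(1) False order_mult[of p q a] order_0I[OF assms(2)] by (simp add: order_divides)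
qed simp

lemma prod_linear_power_dvd:
  fixes x :: "'i \<Rightarrow> complex"
  assumes "finite A" "inj_on x A" "\<And>i. i \<in> A \<Longrightarrow> [:- x i, 1:] ^ m dvd c"
  shows "(\<Prod>i\<in>A. [:- x i, 1:]) ^ m dvd c"
  using assms
proof (induction A rule: finite_induct)
  case (insert i A)
  then obtain r where r: "c = (\<Prod>i\<in>A. [:- x i, 1:]) ^ m * r"
    by (auto simp: dvd_def)
  have "poly ((\<Prod>i\<in>A. [:- x i, 1:]) ^ m) (x i) \<noteq> 0"
    using insert.hyps insert.prems(1) by (auto simp: poly_prod inj_on_def)
  moreover have "[:- x i, 1:] ^ m dvd (\<Prod>i\<in>A. [:- x i, 1:]) ^ m * r"
    using insert.prems(2)[of i] unfolding r by blast
  ultimately have "[:- x i, 1:] ^ m dvd r"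
    by (rule linear_power_dvd_mult_cancel[rotated])
  then have "[:- x i, 1:] ^ m * (\<Prod>i\<in>A. [:- x i, 1:]) ^ m dvd c"
    unfolding r by (subst mult.commute) (rule mult_dvd_mono[OF dvd_refl])
  then show ?case
    unfolding prod.insert[OF insert.hyps] power_mult_distrib .
qed simp

section \<open>The parametrisation by a syzygy basis\<close>

text \<open>The degrees in \<open>X\<close> of the coefficients of a binary form of degree \<open>n\<close> in \<open>F\<close> and \<open>G\<close> when the form has
  been obtained by Cramer's rule: the coordinate of \<open>F\<close> has the degree \<open>k'\<close> of \<open>G\<close>, and that
  of \<open>G\<close> has the degree \<open>k\<close> of \<open>F\<close>.\<close>

definition weighted_degree_le :: "nat \<Rightarrow> nat \<Rightarrow> nat \<Rightarrow> nat \<Rightarrow> complex poly poly \<Rightarrow> bool" where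
  "weighted_degree_le k k' a n p \<longleftrightarrow>
     (\<forall>j. coeff p j \<noteq> 0 \<longrightarrow> j \<le> n \<and> degree (coeff p j) \<le> a + j * k' + (n - j) * k)"

lemma weighted_degree_le_mult:
  assumes "weighted_degree_le k k' a n p" "weighted_degree_le k k' c l q"
  shows "weighted_degree_le k k' (a + c) (n + l) (p * q)"
  unfolding weighted_degree_le_def
proof (intro allI impI)
  fix j assume nz: "coeff (p * q) j \<noteq> 0"
  have bound: "i \<le> n \<and> j - i \<le> l \<and> degree (coeff p i * coeff q (j - i)) \<le> a + c + j * k' + (n + l - j) * k"
    if "i \<le> j" "coeff p i * coeff q (j - i) \<noteq> 0" for i
  proof -
    obtain r where r: "j = i + r" using \<open>i \<le> j\<close> le_iff_add by blast
    have i: "i \<le> n" "degree (coeff p i) \<le> a + i * k' + (n - i) * k"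
      and j: "r \<le> l" "degree (coeff q r) \<le> c + r * k' + (l - r) * k"
      using assms that r by (auto simp: weighted_degree_le_def)
    have "n + l - j = (n - i) + (l - r)" using i(1) j(1) r by simp
    then have "a + c + j * k' + (n + l - j) * k =
        (a + i * k' + (n - i) * k) + (c + r * k' + (l - r) * k)"
      by (simp add: r distrib_right)
    moreover have "degree (coeff p i * coeff q r) \<le> degree (coeff p i) + degree (coeff q r)"
      by (rule degree_mult_le)
    ultimately show ?thesis using i j r by simp
  qed
  have "\<exists>i\<le>j. coeff p i * coeff q (j - i) \<noteq> 0"
    using nz by (metis (no_types, lifting) atMost_iff coeff_mult sum.neutral)
  then have "j \<le> n + l" using bound by force
  moreover have "degree (coeff (p * q) j) \<le> a + c + j * k' + (n + l - j) * k"
    unfolding coeff_mult by (intro degree_sum_le) (use bound in \<open>auto, metis degree_0 le0\<close>)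
  ultimately show "j \<le> n + l \<and> degree (coeff (p * q) j) \<le> a + c + j * k' + (n + l - j) * k"
    by simp
qed

lemma weighted_degree_le_power:
  assumes "weighted_degree_le k k' 0 1 p"
  shows "weighted_degree_le k k' 0 n (p ^ n)"
proof (induction n)
  case (Suc n)
  then show ?case using weighted_degree_le_mult[OF assms Suc] by simp
qed (auto simp: weighted_degree_le_def)

lemma weighted_degree_le_sum:
  assumes "\<And>i. i \<in> A \<Longrightarrow> weighted_degree_le k k' a n (f i)"
  shows "weighted_degree_le k k' a n (sum f A)"
  unfolding weighted_degree_le_def coeff_sum
proof (intro allI impI conjI)
  fix j assume nz: "(\<Sum>i\<in>A. coeff (f i) j) \<noteq> 0"
  then obtain i where "i \<in> A" "coeff (f i) j \<noteq> 0" by (meson sum.neutral)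
  then show "j \<le> n" using assms by (auto simp: weighted_degree_le_def)
  have "finite A" using nz by (metis sum.infinite)
  then show "degree (\<Sum>i\<in>A. coeff (f i) j) \<le> a + j * k' + (n - j) * k"
    using assms by (intro degree_sum_le) (auto simp: weighted_degree_le_def, metis degree_0 le0)
qed

lemma smult_cancel:
  fixes p q :: "'a::idom poly"
  assumes "smult c p = smult c q" "c \<noteq> 0"
  shows "p = q"
  using assms by (simp add: poly_eq_iff)

text \<open>\<open>f0 + f1 * Y\<close> and \<open>g0 + g1 * Y\<close> vanish at the points, and the determinant condition makes them a
  basis, over \<open>\<complex>[X]\<close>, of all forms of degree one in \<open>Y\<close> that do so.\<close>

locale syzygy_basis =
  fixes s k k' :: nat and x y :: "nat \<Rightarrow> complex" and f0 f1 g0 g1 :: "complex poly"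
  assumes ranks: "k + k' = s"
    and distinct_x: "inj_on x {..<s}"
    and degrees: "degree f0 \<le> k" "degree f1 \<le> k" "degree g0 \<le> k'" "degree g1 \<le> k'"
    and f_zero: "i < s \<Longrightarrow> poly f0 (x i) + y i * poly f1 (x i) = 0"
    and g_zero: "i < s \<Longrightarrow> poly g0 (x i) + y i * poly g1 (x i) = 0"
    and det: "f0 * g1 - f1 * g0 = (\<Prod>i<s. [:- x i, 1:])"
begin

abbreviation "D \<equiv> \<Prod>i<s. [:- x i, 1:]"
abbreviation "F \<equiv> [:f0, f1:]"
abbreviation "G \<equiv> [:g0, g1:]"
text \<open>By Cramer's rule \<open>D * Y0 = f0 * G - g0 * F\<close> and \<open>D * Y1 = g1 * F - f1 * G\<close>. With the outer variable
  \<open>T\<close> standing for \<open>F\<close>, and \<open>1\<close> for \<open>G\<close>, these are \<open>U\<close> and \<open>V\<close>.\<close>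

abbreviation "U \<equiv> [:f0, - g0:]"
abbreviation "V \<equiv> [:- f1, g1:]"

lemma D_nonzero: "D \<noteq> 0"
  by (simp add: prod_zero_iff)

lemma degree_D: "degree D = s"
  by (subst degree_prod_eq_sum_degree) auto

lemma subst_inverse_left:
  assumes "degree p \<le> b"
  shows "binary_subst b (binary_subst b p U V) F G = smult (D ^ b) p"
proof -
  have "smult f0 G + smult (- g0) F = smult D [:0, 1:]" "smult (- f1) G + smult g1 F = smult D 1"
    using det by (simp_all add: one_pCons algebra_simps)
  then show ?thesis
    using pcompose_eq_binary_subst[OF assms, of "[:0, 1:]"]
    by (simp only: binary_subst_compose binary_subst_homogeneous pcompose_idR)
qed

lemma subst_inverse_right:
  assumes "degree p \<le> b"
  shows "binary_subst b (binary_subst b p F G) U V = smult (D ^ b) p"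
proof -
  have "smult f0 V + smult f1 U = smult D [:0, 1:]" "smult g0 V + smult g1 U = smult D 1"
    using det by (simp_all add: one_pCons algebra_simps)
  then show ?thesis
    using pcompose_eq_binary_subst[OF assms, of "[:0, 1:]"]
    by (simp only: binary_subst_compose binary_subst_homogeneous pcompose_idR)
qed

text \<open>A polynomial of multiplicity \<open>m\<close> is a combination of
  \<open>(X - x i) ^ (m - j) * (Y0 - y i * Y1) ^ j\<close>. Under the substitution the linear form
  \<open>Y0 - y i * Y1\<close> becomes \<open>(f0 + y i * f1) - (g0 + y i * g1) * T\<close>, and both coefficients vanish at
  \<open>x i\<close> because \<open>F\<close> and \<open>G\<close> pass through the point. So every term acquires the full power
  \<open>(X - x i) ^ m\<close>.\<close>

lemma vanishing_dvd_subst: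
  assumes i: "i < s" and p: "degree p \<le> b" and v: "vanishes_to (x i) (y i) m p"
  shows "[:- x i, 1:] ^ m dvd coeff (binary_subst b p U V) n"
proof -
  let ?l = "[:- x i, 1:]" and ?p = "pcompose p [:[:y i:], 1:]"
  have "?l dvd f0 + smult (y i) f1" "?l dvd g0 + smult (y i) g1"
    using f_zero[OF i] g_zero[OF i] by (simp_all flip: poly_eq_0_iff_dvd)
  then obtain r t where rt: "f0 + smult (y i) f1 = ?l * r" "g0 + smult (y i) g1 = ?l * t"
    by (auto simp: dvd_def)
  define R where "R = [:r, - t:]"
  have "smult [:- y i:] V + smult 1 U = [:f0 + smult (y i) f1, - (g0 + smult (y i) g1):]"
    by (simp add: algebra_simps)
  also have "\<dots> = smult ?l R"
    by (simp only: rt R_def) simp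
  finally have R: "smult [:- y i:] V + smult 1 U = smult ?l R" .
  have "p = pcompose ?p [:[:- y i:], 1:]"
    by (simp add: pcompose_pCons flip: pcompose_assoc)
  also have "\<dots> = binary_subst b ?p [:[:- y i:], 1:] [:1, 0:]"
    using p by (subst pcompose_eq_binary_subst[of _ b]) (simp_all add: degree_pcompose one_pCons)
  finally have p_eq: "p = binary_subst b ?p [:[:- y i:], 1:] [:1, 0:]" .
  have "binary_subst b p U V = binary_subst b ?p (smult ?l R) V"
    using arg_cong[OF p_eq, of "\<lambda>p. binary_subst b p U V"]
    by (simp only: binary_subst_compose R[unfolded smult_1_left] smult_1_left smult_0_left add_0_right)
  also have "coeff \<dots> n = (\<Sum>j\<le>b. coeff ?p j * ?l ^ j * coeff (R ^ j * V ^ (b - j)) n)"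
    by (simp add: binary_subst_def coeff_sum smult_power mult.assoc)
  also have "?l ^ m dvd \<dots>"
  proof (rule dvd_sum)
    fix j
    have "?l ^ m dvd ?l ^ (m - j + j)" by (rule le_imp_power_dvd) simp
    also have "?l ^ (m - j + j) dvd coeff ?p j * ?l ^ j"
      using v by (auto simp: vanishes_to_def power_add intro: mult_dvd_mono)
    finally show "?l ^ m dvd coeff ?p j * ?l ^ j * coeff (R ^ j * V ^ (b - j)) n"
      by (rule dvd_mult2)
  qed
  finally show ?thesis .
qed

text \<open>The polynomial with coordinates \<open>h\<close>: it has multiplicity \<open>m - b\<close> from the fibres through the points
  and multiplicity \<open>b\<close> from the form of degree \<open>b\<close> in \<open>F\<close> and \<open>G\<close>.\<close>

definition param :: "nat \<Rightarrow> nat \<Rightarrow> complex poly poly \<Rightarrow> complex poly poly" where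
  "param m b h = smult (D ^ (m - b)) (binary_subst b h F G)"

text \<open>The bound is \<open>s * (m - b) + degree h\<^sub>j + j * k + (b - j) * k' \<le> a\<close>, rewritten with \<open>s = k + k'\<close> so
  that it matches the degrees produced by Cramer's rule.\<close>

definition admissible :: "nat \<Rightarrow> nat \<Rightarrow> nat \<Rightarrow> complex poly poly \<Rightarrow> bool" where
  "admissible a b m h \<longleftrightarrow> degree h \<le> b \<and>
     (\<forall>j. coeff h j \<noteq> 0 \<longrightarrow> s * m + degree (coeff h j) \<le> a + j * k' + (b - j) * k)"

text \<open>The substituted polynomial is divisible by \<open>D ^ m\<close>, since it is divisible by the powers of the
  distinct linear factors of \<open>D\<close>; the quotient is the required \<open>h\<close>, because substituting back
  multiplies by only \<open>D ^ b\<close>.\<close>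

lemma param_surj:
  assumes bm: "b \<le> m" and p: "bidegree_le a b p" and v: "\<And>i. i < s \<Longrightarrow> vanishes_to (x i) (y i) m p"
  shows "\<exists>h. admissible a b m h \<and> p = param m b h"
proof -
  define q where "q = binary_subst b p U V"
  have deg: "degree p \<le> b" "\<And>j. degree (coeff p j) \<le> a"
    using p by (auto simp: bidegree_le_def)
  have "[:D ^ m:] dvd q"
    unfolding const_poly_dvd_iff q_def
    using vanishing_dvd_subst[OF _ deg(1) v] distinct_x by (auto intro!: prod_linear_power_dvd)
  then obtain h where h: "q = smult (D ^ m) h" by (auto simp: dvd_def)
  have U: "weighted_degree_le k k' 0 1 U" and V: "weighted_degree_le k k' 0 1 V"
    using degrees by (auto simp: weighted_degree_le_def coeff_pCons split: nat.splits)
  have "weighted_degree_le k k' (a + 0) (0 + (j + (b - j))) (smult (coeff p j) (U ^ j * V ^ (b - j)))"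
    if "j \<le> b" for j
  proof -
    have "weighted_degree_le k k' a 0 [:coeff p j:]"
      using deg(2)[of j] by (auto simp: weighted_degree_le_def coeff_pCons split: nat.splits)
    from weighted_degree_le_mult[OF this weighted_degree_le_mult[OF weighted_degree_le_power[OF U, of j] weighted_degree_le_power[OF V, of "b - j"]]]
    show ?thesis by simp
  qed
  then have q: "weighted_degree_le k k' a b q"
    unfolding q_def binary_subst_def by (intro weighted_degree_le_sum) simp
  have "degree h \<le> b"
    using q by (intro degree_le) (auto simp: weighted_degree_le_def h leD D_nonzero)
  moreover have "s * m + degree (coeff h j) \<le> a + j * k' + (b - j) * k" if "coeff h j \<noteq> 0" for j
    using q that D_nonzero
    by (auto simp: weighted_degree_le_def h degree_mult_eq degree_power_eq degree_D mult.commute)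
  moreover have "p = param m b h"
  proof (rule smult_cancel)
    have "smult (D ^ b) p = binary_subst b q F G"
      using subst_inverse_left[OF deg(1)] by (simp add: q_def)
    also have "\<dots> = smult (D ^ (b + (m - b))) (binary_subst b h F G)"
      using bm by (simp add: h binary_subst_smult)
    finally show "smult (D ^ b) p = smult (D ^ b) (param m b h)"
      by (simp add: param_def power_add)
  qed (use D_nonzero in simp)
  ultimately show ?thesis by (auto simp: admissible_def)
qed

lemma param_inj:
  assumes "degree h \<le> b" "param m b h = 0"
  shows "h = 0"
proof -
  have "D ^ (m - b) \<noteq> 0" "D ^ b \<noteq> 0"
    using D_nonzero by simp_all
  then have "binary_subst b h F G = 0"
    using assms(2) unfolding param_def smult_eq_0_iff by blast
  then have "smult (D ^ b) h = 0"
    using subst_inverse_right[OF assms(1)] by (simp only: binary_subst_zero)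
  then show ?thesis
    using \<open>D ^ b \<noteq> 0\<close> by (simp only: smult_eq_0_iff) blast
qed

lemma xdegree_le_param:
  assumes bm: "b \<le> m" and h: "admissible a b m h"
  shows "xdegree_le a (param m b h)"
proof -
  have F: "xdegree_le k F" and G: "xdegree_le k' G"
    using degrees by (simp_all add: xdegree_le_linear)
  have "xdegree_le a (smult (D ^ (m - b)) (smult (coeff h j) (F ^ j * G ^ (b - j))))" if "j \<le> b" for j
  proof (cases "coeff h j = 0")
    case False
    with h have le: "s * m + degree (coeff h j) \<le> a + j * k' + (b - j) * k"
      by (simp add: admissible_def)
    have "s * m = s * (m - b) + (k + k') * (j + (b - j))"
      using bm that ranks by (simp flip: distrib_left)
    then have *: "(s * (m - b) + degree (coeff h j)) + (j * k + (b - j) * k') \<le> a"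
      using le by (simp add: algebra_simps)
    have "degree (D ^ (m - b) * coeff h j) \<le> s * (m - b) + degree (coeff h j)"
      by (rule order.trans[OF degree_mult_le]) (simp add: D_nonzero degree_power_eq degree_D)
    from xdegree_le_smult[OF this xdegree_le_mult[OF xdegree_le_power[OF F] xdegree_le_power[OF G]], of j "b - j"]
    show ?thesis using * unfolding smult_smult xdegree_le_def by (blast intro: order.trans)
  qed (simp add: xdegree_le_def)
  then show ?thesis
    unfolding param_def binary_subst_def smult_sum_right by (intro xdegree_le_sum) auto
qed

lemma bidegree_le_param:
  assumes bm: "b \<le> m" and h: "admissible a b m h"
  shows "bidegree_le a b (param m b h)"
proof -
  have "degree (F ^ j * G ^ (b - j)) \<le> b" if "j \<le> b" for j
    using degree_linear_power_le[of f0 f1 j] degree_linear_power_le[of g0 g1 "b - j"] that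
    by (intro order.trans[OF degree_mult_le]) simp
  then have "degree (param m b h) \<le> b"
    unfolding param_def binary_subst_def
    by (intro order.trans[OF degree_smult_le] degree_sum_le) auto
  then show ?thesis
    using xdegree_le_param[OF assms] by (simp add: bidegree_le_def xdegree_le_def)
qed

lemma vanishes_to_param:
  assumes bm: "b \<le> m" and i: "i < s"
  shows "vanishes_to (x i) (y i) m (param m b h)"
proof -
  have F: "vanishes_to (x i) (y i) 1 F" and G: "vanishes_to (x i) (y i) 1 G"
    using f_zero[OF i] g_zero[OF i] by (simp_all add: vanishes_to_1_iff mult.commute del: One_nat_def)
  have "poly D (x i) = 0"
    using i by (auto simp: poly_prod)
  then have D: "vanishes_to (x i) (y i) 1 [:D:]"
    by (simp add: vanishes_to_1_iff del: One_nat_def)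
  have "vanishes_to (x i) (y i) m (smult (D ^ (m - b)) (smult (coeff h j) (F ^ j * G ^ (b - j))))"
    if "j \<le> b" for j
  proof -
    have "vanishes_to (x i) (y i) ((m - b) + (j + (b - j))) ([:D:] ^ (m - b) * (F ^ j * G ^ (b - j)))"
      by (intro vanishes_to_mult vanishes_to_power D F G)
    then have "vanishes_to (x i) (y i) m ([:coeff h j:] * ([:D:] ^ (m - b) * (F ^ j * G ^ (b - j))))"
      using bm that by (metis vanishes_to_mult_any le_add_diff_inverse le_add_diff_inverse2)
    then show ?thesis
      by (simp add: poly_const_pow mult.commute)
  qed
  then show ?thesis
    unfolding param_def binary_subst_def smult_sum_right by (intro vanishes_to_sum) auto
qed

end

section \<open>The dimension of the space of forms\<close>

lemma dim_of_coordinates: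
  fixes v :: "'i \<Rightarrow> 'v cpoly"
  assumes J: "finite J"
    and indep: "\<And>c. (\<Sum>t\<in>J. poly_scale (c t) (v t)) = 0 \<Longrightarrow> \<forall>t\<in>J. c t = 0"
    and S: "S = {\<Sum>t\<in>J. poly_scale (c t) (v t) | c. True}"
  shows "poly_vs.dim S = card J"
proof -
  have inj: "inj_on v J"
  proof (rule inj_onI, rule ccontr)
    fix s t assume st: "s \<in> J" "t \<in> J" "v s = v t" "s \<noteq> t"
    define c where "c = (\<lambda>r. if r = s then 1 else if r = t then - 1 else (0 :: complex))"
    have "(\<Sum>r\<in>J. poly_scale (c r) (v r)) = (\<Sum>r\<in>{s, t}. poly_scale (c r) (v r))"
      using st J by (intro sum.mono_neutral_right) (auto simp: c_def)
    also have "\<dots> = 0" using st by (simp add: c_def)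
    finally show False using indep st by (fastforce simp: c_def)
  qed
  have "poly_vs.independent (v ` J)"
  proof (rule poly_vs.independent_if_scalars_zero)
    fix f p assume z: "(\<Sum>p\<in>v ` J. poly_scale (f p) p) = 0" and "p \<in> v ` J"
    then show "f p = 0"
      using indep[of "f \<circ> v"] by (auto simp: sum.reindex[OF inj])
  qed (use J in simp)
  moreover have "S = poly_vs.span (v ` J)"
  proof (intro equalityI subsetI)
    fix p assume "p \<in> poly_vs.span (v ` J)"
    then obtain f where "p = (\<Sum>p\<in>v ` J. poly_scale (f p) p)"
      using J by (auto simp: poly_vs.span_finite)
    then have "p = (\<Sum>t\<in>J. poly_scale ((f \<circ> v) t) (v t))"
      by (simp add: sum.reindex[OF inj])
    then show "p \<in> S" unfolding S by blast
  qed (auto simp: S intro: poly_vs.span_sum poly_vs.span_scale poly_vs.span_base)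
  ultimately show ?thesis
    using inj by (simp add: poly_vs.dim_eq_card_independent card_image)
qed

context syzygy_basis
begin

lemma param_sum: "param m b (sum f A) = (\<Sum>i\<in>A. param m b (f i))"
  by (simp add: param_def binary_subst_sum smult_sum_right)

lemma param_smult: "param m b (smult c h) = smult c (param m b h)"
  by (simp add: param_def binary_subst_smult mult.commute)

text \<open>The admissible \<open>h\<close> have the monomials \<open>X ^ i * T ^ j\<close> with \<open>i\<close> below the \<open>j\<close>-th summand as a basis.
  The truncated subtraction gives zero when no nonzero coefficient \<open>h\<^sub>j\<close> satisfies the degree
  bound.\<close>

theorem dim_fat_ideal_part:
  assumes bm: "b \<le> m" and len: "length Ps = s"
    and pts: "\<And>i. i < s \<Longrightarrow> affine_point (Ps ! i) (x i) (y i)"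
  shows "poly_vs.dim (fat_ideal m Ps \<inter> bihom_part a b) = (\<Sum>j\<le>b. a + j * k' + (b - j) * k + 1 - s * m)"
proof -
  define n where "n j = a + j * k' + (b - j) * k + 1 - s * m" for j
  \<comment> \<open>The pairs \<open>(j, i)\<close> are the exponents of the admissible monomials, and \<open>h c\<close> is the polynomial with coefficients \<open>c\<close>.\<close>
  define J where "J = (SIGMA j:{..b}. {..<n j})"
  define h where "h c = (\<Sum>(j, i)\<in>J. monom (monom (c (j, i)) i) j)" for c :: "nat \<times> nat \<Rightarrow> complex"
  define v where "v = (\<lambda>(j, i). rehom a b (param m b (monom (monom 1 i) j)))"
  have fin: "finite J" by (simp add: J_def)
  have coeff_h: "coeff (coeff (h c) j) i = (if (j, i) \<in> J then c (j, i) else 0)" for c j i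
  proof -
    have "coeff (coeff (h c) j) i = (\<Sum>t\<in>J. if (j, i) = t then c t else 0)"
      unfolding h_def coeff_sum by (intro sum.cong) (auto split: if_splits)
    then show ?thesis using fin by simp
  qed
  have adm: "admissible a b m (h c)" for c
    unfolding admissible_def
  proof (intro conjI allI impI)
    show "degree (h c) \<le> b"
      by (rule degree_le) (auto simp: poly_eq_iff coeff_h J_def)
  next
    fix j assume "coeff (h c) j \<noteq> 0"
    then have "(j, degree (coeff (h c) j)) \<in> J"
      using coeff_h[of c j "degree (coeff (h c) j)"] by (auto split: if_splits)
    then show "s * m + degree (coeff (h c) j) \<le> a + j * k' + (b - j) * k"
      by (auto simp: J_def n_def)
  qed
  have h_surj: "\<exists>c. g = h c" if "admissible a b m g" for g
  proof -
    have "coeff (coeff g j) i = 0" if ji: "(j, i) \<notin> J" for j i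
    proof (cases "coeff g j = 0")
      case False
      then have "j \<le> b" "s * m + degree (coeff g j) \<le> a + j * k' + (b - j) * k"
        using \<open>admissible a b m g\<close> by (auto simp: admissible_def intro: le_degree order.trans)
      then have "degree (coeff g j) < i"
        using ji by (auto simp: J_def n_def)
      then show ?thesis by (rule coeff_eq_0)
    qed simp
    then have "g = h (\<lambda>(j, i). coeff (coeff g j) i)"
      by (simp add: poly_eq_iff coeff_h)
    then show ?thesis by blast
  qed
  have lin: "(\<Sum>t\<in>J. poly_scale (c t) (v t)) = rehom a b (param m b (h c))" for c
  proof -
    have "rehom a b (param m b (monom (monom e i) j)) = poly_scale e (v (j, i))" for e i j
    proof -
      have "monom (monom e i) j = smult [:e:] (monom (monom 1 i) j)"
        by (simp add: smult_monom)
      then show ?thesis by (simp only: param_smult rehom_scale v_def prod.case)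
    qed
    then show ?thesis
      by (simp add: h_def param_sum rehom_sum case_prod_beta)
  qed
  have dehom_param: "dehom (rehom a b (param m b (h c))) = param m b (h c)" for c
    by (rule dehom_rehom[OF bidegree_le_param[OF bm adm]])
  have mem: "f \<in> fat_ideal m Ps \<inter> bihom_part a b \<longleftrightarrow>
      f \<in> bihom_part a b \<and> (\<forall>i<s. vanishes_to (x i) (y i) m (dehom f))" for f
  proof -
    have "f \<in> fat_ideal m Ps \<longleftrightarrow> (\<forall>i<s. f \<in> ideal_power (point_ideal (Ps ! i)) m)"
      by (simp add: fat_ideal_def all_set_conv_all_nth len)
    then show ?thesis
      using mem_ideal_power_iff[OF pts _ bm, of _ f a] by blast
  qed
  have "poly_vs.dim (fat_ideal m Ps \<inter> bihom_part a b) = card J"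
  proof (rule dim_of_coordinates[OF fin])
    fix c assume "(\<Sum>t\<in>J. poly_scale (c t) (v t)) = 0"
    then have "param m b (h c) = 0"
      using dehom_param[of c] by (simp add: lin dehom.subst_def)
    then have "h c = 0"
      using param_inj[of "h c" b m] adm[of c] by (simp add: admissible_def)
    then show "\<forall>t\<in>J. c t = 0"
      using coeff_h[of c] by (metis coeff_0 surj_pair)
  next
    show "fat_ideal m Ps \<inter> bihom_part a b = {\<Sum>t\<in>J. poly_scale (c t) (v t) | c. True}"
    proof (intro equalityI subsetI)
      fix f assume f: "f \<in> fat_ideal m Ps \<inter> bihom_part a b"
      then obtain g where g: "admissible a b m g" "dehom f = param m b g"
        using param_surj[OF bm bidegree_le_dehom] mem by blast
      then obtain c where "g = h c" using h_surj by blast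
      then have "f = rehom a b (param m b (h c))"
        using f g rehom_dehom[of f a b] by simp
      then show "f \<in> {\<Sum>t\<in>J. poly_scale (c t) (v t) | c. True}"
        by (auto simp: lin)
    next
      fix f assume "f \<in> {\<Sum>t\<in>J. poly_scale (c t) (v t) | c. True}"
      then obtain c where "f = rehom a b (param m b (h c))" by (auto simp: lin)
      then show "f \<in> fat_ideal m Ps \<inter> bihom_part a b"
        by (simp only: mem dehom_param rehom_bihom) (simp add: vanishes_to_param[OF bm])
    qed
  qed
  then show ?thesis by (simp add: J_def n_def)
qed

end

section \<open>Comparison with the expected value\<close>

lemma sum_positive_parts:
  "(\<Sum>j\<le>b. j - d) = (b + 1 - d) choose 2"
proof (induction b)
  case (Suc b)
  show ?case
  proof (cases "d \<le> b + 1")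
    case True
    then obtain r where "b + 1 = d + r" using le_iff_add by blast
    then show ?thesis
      unfolding sum.atMost_Suc Suc by (simp add: numeral_2_eq_2)
  qed (use Suc in simp)
qed (simp add: numeral_2_eq_2 le_Suc_eq)

lemma two_choose_2: "2 * int (n choose 2) = int n * (int n - 1)"
  by (induction n) (simp_all add: numeral_2_eq_2 algebra_simps)

text \<open>The number of conditions that one point of multiplicity \<open>m\<close> imposes on polynomials of degree
  \<open>b\<close> in \<open>Y\<close>, doubled to avoid a division.\<close>

lemma double_conditions:
  assumes "b \<le> (m::nat)"
  shows "2 * (int ((m + 1) choose 2) - int ((m - b) choose 2)) = (int b + 1) * (2 * int m - int b)"
  unfolding right_diff_distrib two_choose_2 using assms by (simp add: of_nat_diff algebra_simps)

text \<open>For odd \<open>s\<close> the \<open>j\<close>-th summand is the positive part of \<open>z + j\<close>. If \<open>z\<close> is nonnegative nothing is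
  cut off; if \<open>z + b\<close> is nonpositive all summands vanish. In between, the positive values are
  \<open>1, \<dots>, z + b\<close>, with sum \<open>(z + b + 1) choose 2\<close>; the exceptional parameter is \<open>c = z + b - 1\<close>.
  The value \<open>z + b = b\<close>, that is \<open>c = b - 1\<close>, still gives the expected sum, which is why the
  exceptional range ends at \<open>b - 2\<close>.\<close>

lemma hilbert_function_value:
  fixes a b m s k k' dim :: nat
  defines "k \<equiv> s div 2" and "k' \<equiv> s - s div 2"
  assumes bm: "b \<le> m"
    and dim: "dim = (\<Sum>j\<le>b. a + j * k' + (b - j) * k + 1 - s * m)"
  shows "((\<nexists>k c :: nat. s = 2 * k + 1 \<and> c + 2 \<le> b \<and> a = b * k + c + s * (m - b)) \<longrightarrow>
       int ((a + 1) * (b + 1)) - int dim =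
         min (int ((a + 1) * (b + 1)))
             (int s * int ((m + 1) choose 2) - int s * int ((m - b) choose 2))) \<and>
    (\<forall>k c :: nat. s = 2 * k + 1 \<and> c + 2 \<le> b \<and> a = b * k + c + s * (m - b) \<longrightarrow>
       dim = (c + 2) choose 2)"
proof -
  define e where "e = 2 * (int s * int ((m + 1) choose 2) - int s * int ((m - b) choose 2))"
  have e: "e = int s * ((int b + 1) * (2 * int m - int b))"
    unfolding e_def double_conditions[OF bm, symmetric] by (simp add: algebra_simps)
  \<comment> \<open>Twice the expected dimension of the space of forms.\<close>
  define E where "E = 2 * (int a + 1) * (int b + 1) - e"
  have expected: "int ((a + 1) * (b + 1)) - int dim = min (int ((a + 1) * (b + 1)))
      (int s * int ((m + 1) choose 2) - int s * int ((m - b) choose 2)) \<longleftrightarrow> 2 * int dim = max 0 E"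
    unfolding E_def e_def by (simp add: algebra_simps) linarith
  show ?thesis
  proof (cases "even s")
    case True
    then obtain q where s: "s = 2 * q" by blast
    have k: "k = q" "k' = q" by (simp_all add: k_def k'_def s)
    have "dim = (\<Sum>j\<le>b. a + b * q + 1 - s * m)"
      unfolding dim k
    proof (intro sum.cong refl)
      fix j assume "j \<in> {..b}"
      then have "b * q = j * q + (b - j) * q" by (simp flip: distrib_right)
      then show "a + j * q + (b - j) * q + 1 - s * m = a + b * q + 1 - s * m" by simp
    qed
    then have "dim = (b + 1) * (a + b * q + 1 - s * m)"
      by simp
    moreover have "int (u - v) = max 0 (int u - int v)" for u v
      by simp
    ultimately have "2 * int dim = 2 * (int b + 1) * max 0 (int a + int b * int q + 1 - int s * int m)"
      by (simp only: of_nat_mult of_nat_add of_nat_1 mult.assoc)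
    moreover have "E = 2 * (int b + 1) * (int a + int b * int q + 1 - int s * int m)"
      unfolding E_def e by (simp add: s algebra_simps)
    ultimately have "2 * int dim = max 0 E"
      by (simp add: max_def zero_le_mult_iff)
    moreover have "s \<noteq> 2 * r + 1" for r
      using s by presburger
    ultimately show ?thesis using expected by blast
  next
    case False
    then obtain q where s: "s = 2 * q + 1" using oddE by blast
    have k: "k = q" "k' = q + 1" by (simp_all add: k_def k'_def s)
    have dim': "dim = (\<Sum>j\<le>b. a + b * q + 1 + j - s * m)"
      unfolding dim k
    proof (intro sum.cong refl)
      fix j assume "j \<in> {..b}"
      then have "b * q = j * q + (b - j) * q" by (simp flip: distrib_right)
      then show "a + j * (q + 1) + (b - j) * q + 1 - s * m = a + b * q + 1 + j - s * m" by simp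
    qed
    define z where "z = int a + int b * int q + 1 - int s * int m"
    have z: "z = int (a + b * q + 1) - int (s * m)"
      by (simp add: z_def)
    have E: "E = (int b + 1) * (2 * z + int b)"
      unfolding E_def e z_def by (simp add: s algebra_simps)
    have pos: "2 * int dim = E" if "z \<ge> 0"
    proof -
      have "a + b * q + 1 + j - s * m = nat z + j" for j
      proof -
        have "u + j - v = nat (int u - int v) + j" if "int u - int v \<ge> 0" for u v :: nat
          using that by arith
        then show ?thesis using that unfolding z by blast
      qed
      then have "dim = (b + 1) * nat z + ((b + 1) choose 2)"
        using sum_positive_parts[of 0 b] by (simp add: dim' sum.distrib)
      then show ?thesis
        using that by (simp add: E two_choose_2 algebra_simps)
    qed
    have neg: "dim = (b + 1 - nat (- z)) choose 2" if "z < 0"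
    proof -
      have "a + b * q + 1 + j - s * m = j - nat (- z)" for j
      proof -
        have "u + j - v = j - nat (- (int u - int v))" if "int u - int v < 0" for u v :: nat
          using that by arith
        then show ?thesis using that unfolding z by blast
      qed
      then show ?thesis
        by (simp add: dim' sum_positive_parts)
    qed
    have exc: "(a = b * q + c + s * (m - b)) \<longleftrightarrow> int c = z + int b - 1" for c
    proof -
      have "(a = b * q + c + s * (m - b)) \<longleftrightarrow> int a = int (b * q + c + s * (m - b))"
        by (rule of_nat_eq_iff[symmetric])
      also have "\<dots> \<longleftrightarrow> int a = int b * int q + int c + int s * (int m - int b)"
        using bm by (simp add: of_nat_diff)
      finally show ?thesis by (simp add: z_def s algebra_simps) linarith
    qed
    show ?thesis
    proof (intro conjI impI allI)
      assume "\<nexists>k c :: nat. s = 2 * k + 1 \<and> c + 2 \<le> b \<and> a = b * k + c + s * (m - b)"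
      then have nex: "\<not> (c + 2 \<le> b \<and> int c = z + int b - 1)" for c
        using s exc by blast
      have "z \<ge> 0 \<or> z + int b \<le> 0"
        using nex[of "nat (z + int b - 1)"] by linarith
      then have "2 * int dim = max 0 E"
      proof
        assume "z \<ge> 0"
        moreover from this have "E \<ge> 0" by (simp add: E)
        ultimately show ?thesis using pos by simp
      next
        assume zb: "z + int b \<le> 0"
        then show ?thesis
        proof (cases "z < 0")
          case True
          have "E \<le> 0" using zb True by (auto simp: E intro: mult_nonneg_nonpos)
          moreover have "b + 1 - nat (- z) < 2" using zb by linarith
          ultimately show ?thesis using neg[OF True] by simp
        qed (use zb pos E in simp)
      qed
      then show "int ((a + 1) * (b + 1)) - int dim = min (int ((a + 1) * (b + 1)))
          (int s * int ((m + 1) choose 2) - int s * int ((m - b) choose 2))"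
        using expected by blast
    next
      fix k c assume H: "s = 2 * k + 1 \<and> c + 2 \<le> b \<and> a = b * k + c + s * (m - b)"
      then have "k = q" using s by simp
      with H exc have c: "int c = z + int b - 1" "c + 2 \<le> b" by auto
      then have "z < 0" "b + 1 - nat (- z) = c + 2" by linarith+
      then show "dim = (c + 2) choose 2" using neg by simp
    qed
  qed
qed

section \<open>Existence of a balanced syzygy basis\<close>

text \<open>The determinant vanishes at every \<open>x i\<close>, where \<open>(f0, f1)\<close> and \<open>(g0, g1)\<close> are both proportional to \<open>(- y i, 1)\<close>, and its
  degree is at most \<open>s\<close>. If nonzero, it is therefore a constant multiple of \<open>D\<close>, and rescaling
  \<open>g0\<close> and \<open>g1\<close> removes the constant.\<close>

lemma syzygy_basis_of_nonzero_det:
  assumes "k + k' = s" "inj_on x {..<s}"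
    and degrees: "degree f0 \<le> k" "degree f1 \<le> k" "degree g0 \<le> k'" "degree g1 \<le> k'"
    and f_zero: "\<And>i. i < s \<Longrightarrow> poly f0 (x i) + y i * poly f1 (x i) = 0"
    and g_zero: "\<And>i. i < s \<Longrightarrow> poly g0 (x i) + y i * poly g1 (x i) = 0"
    and nz: "f0 * g1 - f1 * g0 \<noteq> 0"
  shows "\<exists>g0 g1. syzygy_basis s k k' x y f0 f1 g0 g1"
proof -
  let ?D = "\<Prod>i<s. [:- x i, 1:]" and ?Q = "f0 * g1 - f1 * g0"
  have deg_D: "degree ?D = s"
    by (subst degree_prod_eq_sum_degree) auto
  have zero: "poly ?Q (x i) = 0" if "i < s" for i
  proof -
    have "poly f0 (x i) = - (y i * poly f1 (x i))" "poly g0 (x i) = - (y i * poly g1 (x i))"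
      using f_zero[OF that] g_zero[OF that] by (simp_all add: eq_neg_iff_add_eq_0)
    then show ?thesis by simp
  qed
  have "?D ^ 1 dvd ?Q"
  proof (rule prod_linear_power_dvd)
    show "[:- x i, 1:] ^ 1 dvd ?Q" if "i \<in> {..<s}" for i
      using zero[of i] that by (simp only: power_one_right lessThan_iff flip: poly_eq_0_iff_dvd)
  qed (use assms(2) in simp_all)
  then obtain c where c: "?Q = ?D * c" by (auto simp: dvd_def)
  have "degree ?Q \<le> s"
    using degrees assms(1) by (intro degree_diff_le order.trans[OF degree_mult_le]) auto
  moreover have "?D \<noteq> 0" "c \<noteq> 0" using nz c by auto
  ultimately have "degree c = 0"
    using degree_mult_eq[of ?D c] deg_D c by simp
  then obtain d where d: "c = [:d:]" by (rule degree_eq_zeroE)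
  with \<open>c \<noteq> 0\<close> have "d \<noteq> 0" by simp
  have "syzygy_basis s k k' x y f0 f1 (smult (inverse d) g0) (smult (inverse d) g1)"
  proof
    fix i assume "i < s"
    then show "poly (smult (inverse d) g0) (x i) + y i * poly (smult (inverse d) g1) (x i) = 0"
      using g_zero[of i] \<open>d \<noteq> 0\<close> by (simp add: field_simps)
  next
    have "f0 * smult (inverse d) g1 - f1 * smult (inverse d) g0 = smult (inverse d) ?Q"
      by (simp add: smult_diff_right)
    also have "\<dots> = ?D"
      unfolding c d using \<open>d \<noteq> 0\<close> by simp
    finally show "f0 * smult (inverse d) g1 - f1 * smult (inverse d) g0 = ?D" .
  qed (use assms in \<open>auto intro: order.trans[OF degree_smult_le]\<close>)
  then show ?thesis by blast
qed

text \<open>Prescribe the leading coefficients: \<open>f1\<close> and \<open>g0\<close> shall be monic of degree \<open>k\<close>, and \<open>f0\<close>, \<open>g1\<close> of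
  smaller degree. Vanishing at the points is then an interpolation problem for the lower
  coefficients, and the determinant has top coefficient \<open>-1\<close>, so it is not zero.\<close>

lemma even_syzygy_basis:
  assumes inj: "inj_on x {..<2 * k}"
    and solv: "\<And>r. \<exists>p0 p1. (\<forall>j\<ge>k. coeff p0 j = 0) \<and> (\<forall>j\<ge>k. coeff p1 j = 0) \<and>
      (\<forall>i<2 * k. poly p0 (x i) + y i * poly p1 (x i) = (r i :: complex))"
  shows "\<exists>f0 f1 g0 g1. syzygy_basis (2 * k) k k x y f0 f1 g0 g1"
proof -
  obtain p0 p1 where p: "\<And>j. j \<ge> k \<Longrightarrow> coeff p0 j = 0" "\<And>j. j \<ge> k \<Longrightarrow> coeff p1 j = 0"
    "\<And>i. i < 2 * k \<Longrightarrow> poly p0 (x i) + y i * poly p1 (x i) = - (y i * x i ^ k)"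
    using solv[of "\<lambda>i. - (y i * x i ^ k)"] by blast
  obtain q0 q1 where q: "\<And>j. j \<ge> k \<Longrightarrow> coeff q0 j = 0" "\<And>j. j \<ge> k \<Longrightarrow> coeff q1 j = 0"
    "\<And>i. i < 2 * k \<Longrightarrow> poly q0 (x i) + y i * poly q1 (x i) = - (x i ^ k)"
    using solv[of "\<lambda>i. - (x i ^ k)"] by blast
  define f1 where "f1 = monom 1 k + p1"
  define g0 where "g0 = monom 1 k + q0"
  have deg: "degree p0 \<le> k" "degree f1 \<le> k" "degree g0 \<le> k" "degree q1 \<le> k"
    using p q by (auto intro!: degree_le simp: f1_def g0_def)
  have top: "coeff (p * q) (k + k) = coeff p k * coeff q k" if "degree p \<le> k" "degree q \<le> k" for p q :: "complex poly"
  proof -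
    have "coeff (p * q) (k + k) = (\<Sum>i\<le>k + k. if i = k then coeff p k * coeff q k else 0)"
      unfolding coeff_mult
    proof (intro sum.cong refl)
      fix i assume "i \<in> {..k + k}"
      show "coeff p i * coeff q (k + k - i) = (if i = k then coeff p k * coeff q k else 0)"
        using that coeff_eq_0[of p i] coeff_eq_0[of q "k + k - i"] by (cases i k rule: linorder_cases) auto
    qed
    then show ?thesis by simp
  qed
  have "coeff (p0 * q1 - f1 * g0) (k + k) = - 1"
  proof -
    have "coeff f1 k = 1" "coeff g0 k = 1" "coeff p0 k = 0"
      using p q by (simp_all add: f1_def g0_def)
    then show ?thesis by (simp add: top deg)
  qed
  then have "p0 * q1 - f1 * g0 \<noteq> 0" by auto
  moreover have "poly p0 (x i) + y i * poly f1 (x i) = 0" "poly g0 (x i) + y i * poly q1 (x i) = 0"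
    if "i < 2 * k" for i
    using p(3)[OF that] q(3)[OF that]
    by (simp_all add: f1_def g0_def poly_monom distrib_left eq_neg_iff_add_eq_0 add_ac)
  ultimately show ?thesis
    using syzygy_basis_of_nonzero_det[of k k "2 * k" x p0 f1 g0 q1 y] inj deg mult_2[of k] by metis
qed

text \<open>Elementary transformation at the new point \<open>P\<close>: \<open>F(P) * G - G(P) * F\<close> passes through \<open>P\<close>, and so does
  the product of \<open>F\<close> or \<open>G\<close> with the equation of the fibre through \<open>P\<close>. The values \<open>F(P)\<close> and
  \<open>G(P)\<close> are not both zero because \<open>D\<close> does not vanish at the new abscissa; multiplying the basis
  element whose value is nonzero keeps the determinant nonzero.\<close>

lemma odd_syzygy_basis:
  assumes inj: "inj_on x {..<Suc s}" and basis: "syzygy_basis s k k x y f0 f1 g0 g1"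
  shows "\<exists>f0 f1 g0 g1. syzygy_basis (Suc s) k (Suc k) x y f0 f1 g0 g1"
proof -
  interpret syzygy_basis s k k x y f0 f1 g0 g1 by (rule basis)
  define \<alpha> where "\<alpha> = poly f0 (x s) + y s * poly f1 (x s)"
  define \<beta> where "\<beta> = poly g0 (x s) + y s * poly g1 (x s)"
  define a0 where "a0 = smult \<alpha> g0 - smult \<beta> f0"
  define a1 where "a1 = smult \<alpha> g1 - smult \<beta> f1"
  let ?l = "[:- x s, 1:]"
  have a_deg: "degree a0 \<le> k" "degree a1 \<le> k"
    using degrees unfolding a0_def a1_def
    by (auto intro!: degree_diff_le order.trans[OF degree_smult_le])
  have l_deg: "degree (?l * p) \<le> Suc k" if "degree p \<le> k" for p
    using that by (intro order.trans[OF degree_mult_le]) simp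
  have a_zero: "poly a0 (x i) + y i * poly a1 (x i) = 0" if "i < Suc s" for i
  proof -
    have "poly a0 (x i) + y i * poly a1 (x i) =
        \<alpha> * (poly g0 (x i) + y i * poly g1 (x i)) - \<beta> * (poly f0 (x i) + y i * poly f1 (x i))"
      by (simp add: a0_def a1_def algebra_simps)
    also have "\<dots> = 0"
    proof (cases "i = s")
      case False
      then show ?thesis using f_zero[of i] g_zero[of i] that by simp
    qed (simp flip: \<alpha>_def \<beta>_def)
    finally show ?thesis .
  qed
  have l_zero: "poly (?l * p0) (x i) + y i * poly (?l * p1) (x i) = 0"
    if "i < Suc s" "\<And>i. i < s \<Longrightarrow> poly p0 (x i) + y i * poly p1 (x i) = 0" for i p0 p1
  proof (cases "i = s")
    case False
    have "poly (?l * p0) (x i) + y i * poly (?l * p1) (x i) =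
        poly ?l (x i) * (poly p0 (x i) + y i * poly p1 (x i))"
      by (simp only: poly_mult) (simp add: algebra_simps)
    then show ?thesis using False that by simp
  qed simp
  have extend: "\<exists>f0 f1 g0 g1. syzygy_basis (Suc s) k (Suc k) x y f0 f1 g0 g1"
    if p: "degree p0 \<le> k" "degree p1 \<le> k" "\<And>i. i < s \<Longrightarrow> poly p0 (x i) + y i * poly p1 (x i) = 0"
      and nz: "a0 * (?l * p1) - a1 * (?l * p0) \<noteq> 0" for p0 p1
  proof -
    have "\<exists>g0 g1. syzygy_basis (Suc s) k (Suc k) x y a0 a1 g0 g1"
    proof (rule syzygy_basis_of_nonzero_det[where ?g0.0 = "?l * p0" and ?g1.0 = "?l * p1"])
      show "k + Suc k = Suc s" using ranks by simp
      show "poly (?l * p0) (x i) + y i * poly (?l * p1) (x i) = 0" if "i < Suc s" for i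
        using that p(3) by (rule l_zero)
    qed (fact inj a_deg a_zero nz l_deg[OF p(1)] l_deg[OF p(2)])+
    then show ?thesis by blast
  qed
  have l_nz: "?l * D \<noteq> 0" using D_nonzero by (simp only: mult_eq_0_iff) simp
  have "\<alpha> \<noteq> 0 \<or> \<beta> \<noteq> 0"
  proof (rule ccontr)
    assume "\<not> (\<alpha> \<noteq> 0 \<or> \<beta> \<noteq> 0)"
    then have "poly f0 (x s) = - (y s * poly f1 (x s))" "poly g0 (x s) = - (y s * poly g1 (x s))"
      by (simp_all add: \<alpha>_def \<beta>_def eq_neg_iff_add_eq_0)
    then have "poly (f0 * g1 - f1 * g0) (x s) = 0" by simp
    then have "\<exists>i<s. x s = x i" by (auto simp: det poly_prod)
    then obtain i where "i < s" "x s = x i" by blast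
    with inj_onD[OF inj, of s i] show False by simp
  qed
  then show ?thesis
  proof
    assume "\<alpha> \<noteq> 0"
    have "a0 * f1 - a1 * f0 = smult (- \<alpha>) (f0 * g1 - f1 * g0)"
      by (simp add: a0_def a1_def smult_diff_right algebra_simps)
    then have "a0 * (?l * f1) - a1 * (?l * f0) = smult (- \<alpha>) (?l * (f0 * g1 - f1 * g0))"
      by (metis mult.left_commute mult_smult_right right_diff_distrib)
    then have "a0 * (?l * f1) - a1 * (?l * f0) \<noteq> 0"
      using l_nz \<open>\<alpha> \<noteq> 0\<close> unfolding det by (simp only: smult_eq_0_iff) simp
    with degrees f_zero show ?thesis by (intro extend[of f0 f1])
  next
    assume "\<beta> \<noteq> 0"
    have "a0 * g1 - a1 * g0 = smult (- \<beta>) (f0 * g1 - f1 * g0)"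
      by (simp add: a0_def a1_def smult_diff_right algebra_simps)
    then have "a0 * (?l * g1) - a1 * (?l * g0) = smult (- \<beta>) (?l * (f0 * g1 - f1 * g0))"
      by (metis mult.left_commute mult_smult_right right_diff_distrib)
    then have "a0 * (?l * g1) - a1 * (?l * g0) \<noteq> 0"
      using l_nz \<open>\<beta> \<noteq> 0\<close> unfolding det by (simp only: smult_eq_0_iff) simp
    with degrees g_zero show ?thesis by (intro extend[of g0 g1])
  qed
qed

lemma balanced_syzygy_basis:
  assumes inj: "inj_on x {..<s}" and k: "k = s div 2"
    and solv: "\<And>r. \<exists>p0 p1. (\<forall>j\<ge>k. coeff p0 j = 0) \<and> (\<forall>j\<ge>k. coeff p1 j = 0) \<and>
      (\<forall>i<2 * k. poly p0 (x i) + y i * poly p1 (x i) = (r i :: complex))"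
  shows "\<exists>f0 f1 g0 g1. syzygy_basis s k (s - k) x y f0 f1 g0 g1"
proof -
  have "inj_on x {..<2 * k}" using inj by (rule inj_on_subset) (auto simp: k)
  from even_syzygy_basis[OF this solv] obtain f0 f1 g0 g1
    where basis: "syzygy_basis (2 * k) k k x y f0 f1 g0 g1" by blast
  show ?thesis
  proof (cases "even s")
    case True
    then have "s = 2 * k" "s - k = k" by (auto simp: k)
    with basis show ?thesis by auto
  next
    case False
    then have s: "s = Suc (2 * k)" "s - k = Suc k" by (auto simp: k elim: oddE)
    show ?thesis
      using odd_syzygy_basis[OF inj[unfolded s(1)] basis] unfolding s(2) unfolding s(1) .
  qed
qed

section \<open>Multihomogeneous polynomials in the coordinates of the points\<close>

definition point_var :: "nat \<Rightarrow> coord \<Rightarrow> (nat \<times> coord) cpoly" where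
  "point_var i v = Poly_Mapping.single (Poly_Mapping.single (i, v) 1) 1"

lemma eval_point_var: "poly_eval w (point_var i v) = w (i, v)"
  by (simp add: point_var_def eval.subst_single monomial_value_def)

text \<open>Being multihomogeneous is not preserved by sums, so the degrees have to be tracked.\<close>

definition multidegree :: "nat \<Rightarrow> (nat \<Rightarrow> nat) \<Rightarrow> (nat \<Rightarrow> nat) \<Rightarrow> (nat \<times> coord) cpoly \<Rightarrow> bool" where
  "multidegree s d e f \<longleftrightarrow> (\<forall>t\<in>Poly_Mapping.keys f.
     (\<forall>i<s. Poly_Mapping.lookup t (i, X0) + Poly_Mapping.lookup t (i, X1) = d i \<and>
            Poly_Mapping.lookup t (i, Y0) + Poly_Mapping.lookup t (i, Y1) = e i) \<and>
     (\<forall>i v. s \<le> i \<longrightarrow> Poly_Mapping.lookup t (i, v) = 0))"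

lemma multihomogeneous_iff: "multihomogeneous s f \<longleftrightarrow> (\<exists>d e. multidegree s d e f)"
  unfolding multihomogeneous_def multidegree_def ..

lemma multidegree_mult:
  assumes "multidegree s d e f" "multidegree s d' e' g"
  shows "multidegree s (\<lambda>i. d i + d' i) (\<lambda>i. e i + e' i) (f * g)"
  unfolding multidegree_def
proof (rule ballI)
  fix t assume "t \<in> Poly_Mapping.keys (f * g)"
  then obtain r q where t: "t = r + q" and "r \<in> Poly_Mapping.keys f" "q \<in> Poly_Mapping.keys g"
    using keys_mult[of f g] by blast
  with assms have deg: "Poly_Mapping.lookup r (i, X0) + Poly_Mapping.lookup r (i, X1) = d i"
      "Poly_Mapping.lookup r (i, Y0) + Poly_Mapping.lookup r (i, Y1) = e i"
      "Poly_Mapping.lookup q (i, X0) + Poly_Mapping.lookup q (i, X1) = d' i"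
      "Poly_Mapping.lookup q (i, Y0) + Poly_Mapping.lookup q (i, Y1) = e' i" if "i < s" for i
    using that by (simp_all add: multidegree_def)
  from \<open>r \<in> _\<close> \<open>q \<in> _\<close> assms
  have "Poly_Mapping.lookup r (i, v) = 0" "Poly_Mapping.lookup q (i, v) = 0" if "s \<le> i" for i v
    using that by (simp_all add: multidegree_def)
  with deg show "(\<forall>i<s. Poly_Mapping.lookup t (i, X0) + Poly_Mapping.lookup t (i, X1) = d i + d' i \<and>
        Poly_Mapping.lookup t (i, Y0) + Poly_Mapping.lookup t (i, Y1) = e i + e' i) \<and>
      (\<forall>i v. s \<le> i \<longrightarrow> Poly_Mapping.lookup t (i, v) = 0)"
    by (simp add: t lookup_add flip: deg)
qed

lemma multidegree_one: "multidegree s (\<lambda>_. 0) (\<lambda>_. 0) 1"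
  by (simp add: multidegree_def)

lemma multidegree_add: "multidegree s d e f \<Longrightarrow> multidegree s d e g \<Longrightarrow> multidegree s d e (f + g)"
  using keys_add[of f g] by (fastforce simp: multidegree_def)

lemma multidegree_uminus: "multidegree s d e f \<Longrightarrow> multidegree s d e (- f)"
  by (simp add: multidegree_def in_keys_iff)

lemma multidegree_sum:
  "(\<And>i. i \<in> A \<Longrightarrow> multidegree s d e (f i)) \<Longrightarrow> multidegree s d e (sum f A)"
  by (induction A rule: infinite_finite_induct) (simp_all add: multidegree_add, simp_all add: multidegree_def)

lemma multidegree_power:
  "multidegree s d e f \<Longrightarrow> multidegree s (\<lambda>i. n * d i) (\<lambda>i. n * e i) (f ^ n)"
  by (induction n) (simp_all add: multidegree_one multidegree_mult)

lemma multidegree_prod: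
  "(\<And>i. i \<in> A \<Longrightarrow> multidegree s (d i) (e i) (f i)) \<Longrightarrow>
     multidegree s (\<lambda>r. \<Sum>i\<in>A. d i r) (\<lambda>r. \<Sum>i\<in>A. e i r) (prod f A)"
  by (induction A rule: infinite_finite_induct) (simp_all add: multidegree_one multidegree_mult)

lemma multidegree_point_var:
  assumes "i < s"
  shows "multidegree s (\<lambda>r. if r = i \<and> v \<in> {X0, X1} then 1 else 0)
    (\<lambda>r. if r = i \<and> v \<in> {Y0, Y1} then 1 else 0) (point_var i v)"
  using assms by (cases v) (auto simp: multidegree_def point_var_def lookup_single when_def)

lemma multihomogeneous_mult: "multihomogeneous s f \<Longrightarrow> multihomogeneous s g \<Longrightarrow> multihomogeneous s (f * g)"
  unfolding multihomogeneous_iff using multidegree_mult by blast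

lemma multihomogeneous_prod:
  "(\<And>i. i \<in> A \<Longrightarrow> multihomogeneous s (f i)) \<Longrightarrow> multihomogeneous s (prod f A)"
proof (induction A rule: infinite_finite_induct)
  case (insert i A)
  then show ?case by (simp add: multihomogeneous_mult)
qed (auto simp: multihomogeneous_iff intro: multidegree_one)

text \<open>Row \<open>i\<close> consists of the bihomogeneous monomials of bidegree \<open>(k - 1, 1)\<close> evaluated at the \<open>i\<close>-th point,
  first those with \<open>Y1\<close>, then those with \<open>Y0\<close>. The entries lie in an arbitrary ring so that the same
  matrix can be formed from variables and from values.\<close>

definition interpolation_matrix :: "nat \<Rightarrow> (nat \<times> coord \<Rightarrow> 'a::comm_ring_1) \<Rightarrow> 'a mat" where
  "interpolation_matrix k w = mat (2 * k) (2 * k) (\<lambda>(i, j).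
     if j < k then w (i, X0) ^ j * w (i, X1) ^ (k - 1 - j) * w (i, Y1)
     else w (i, X0) ^ (j - k) * w (i, X1) ^ (2 * k - 1 - j) * w (i, Y0))"

lemma interpolation_matrix_carrier: "interpolation_matrix k w \<in> carrier_mat (2 * k) (2 * k)"
  by (simp add: interpolation_matrix_def)

lemma poly_eval_det_interpolation_matrix:
  "poly_eval w (det (interpolation_matrix k (\<lambda>(i, v). point_var i v))) = det (interpolation_matrix k w)"
proof -
  interpret ev: comm_ring_hom "poly_eval w" by (rule eval.subst_hom)
  have "map_mat (poly_eval w) (interpolation_matrix k (\<lambda>(i, v). point_var i v)) = interpolation_matrix k w"
    by (rule eq_matI) (auto simp: interpolation_matrix_def eval_point_var ev.hom_power eval.subst_mult)
  then show ?thesis by (metis ev.hom_det)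
qed

text \<open>Each term of the Leibniz expansion takes one entry from each row, so all terms have the multidegree
  given by the rows.\<close>

lemma multihomogeneous_det_interpolation_matrix:
  assumes "2 * k \<le> s"
  shows "multihomogeneous s (det (interpolation_matrix k (\<lambda>(i, v). point_var i v)))"
proof -
  define A where "A = interpolation_matrix k (\<lambda>(i, v). point_var i v)"
  define d where "d = (\<lambda>i r :: nat. if r = i then k - 1 else 0 :: nat)"
  define e where "e = (\<lambda>i r :: nat. if r = i then 1 else 0 :: nat)"
  have entry: "multidegree s (d i) (e i) (A $$ (i, j))" if "i < 2 * k" "j < 2 * k" for i j
  proof -
    have "i < s" using that assms by simp
    define l where "l = (if j < k then j else j - k)"
    define v where "v = (if j < k then Y1 else Y0)"
    have l: "l \<le> k - 1" using that by (auto simp: l_def)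
    have A: "A $$ (i, j) = point_var i X0 ^ l * point_var i X1 ^ (k - 1 - l) * point_var i v"
      using that by (auto simp: A_def interpolation_matrix_def l_def v_def intro!: arg_cong2[where f = "(*)"] arg_cong2[where f = "(^)"])
    have "d i = (\<lambda>r. l * (if r = i \<and> X0 \<in> {X0, X1} then 1 else 0) +
        (k - 1 - l) * (if r = i \<and> X1 \<in> {X0, X1} then 1 else 0) + (if r = i \<and> v \<in> {X0, X1} then 1 else 0))"
      "e i = (\<lambda>r. l * (if r = i \<and> X0 \<in> {Y0, Y1} then 1 else 0) +
        (k - 1 - l) * (if r = i \<and> X1 \<in> {Y0, Y1} then 1 else 0) + (if r = i \<and> v \<in> {Y0, Y1} then 1 else 0))"
      using l by (auto simp: d_def e_def v_def fun_eq_iff)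
    then show ?thesis
      using multidegree_mult[OF multidegree_mult[OF multidegree_power[OF multidegree_point_var]
        multidegree_power[OF multidegree_point_var]] multidegree_point_var,
        OF \<open>i < s\<close> \<open>i < s\<close> \<open>i < s\<close>, of l X0 "k - 1 - l" X1 v] by (simp only: A)
  qed
  have "multidegree s (\<lambda>r. \<Sum>i = 0..<2 * k. d i r) (\<lambda>r. \<Sum>i = 0..<2 * k. e i r)
      (signof p * (\<Prod>i = 0..<2 * k. A $$ (i, p i)))" if "p permutes {0..<2 * k}" for p
  proof -
    have "multidegree s (\<lambda>r. \<Sum>i = 0..<2 * k. d i r) (\<lambda>r. \<Sum>i = 0..<2 * k. e i r)
        (\<Prod>i = 0..<2 * k. A $$ (i, p i))"
      using permutes_in_image[OF that] by (intro multidegree_prod entry) auto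
    then show ?thesis
      using multidegree_uminus by (auto simp: sign_def)
  qed
  then have "multidegree s (\<lambda>r. \<Sum>i = 0..<2 * k. d i r) (\<lambda>r. \<Sum>i = 0..<2 * k. e i r) (det A)"
    unfolding det_def'[OF interpolation_matrix_carrier[of k, folded A_def]] A_def
    by (intro multidegree_sum) (simp add: A_def)
  then show ?thesis unfolding multihomogeneous_iff A_def by blast
qed

section \<open>Solvability of the interpolation problem\<close>

lemma sum_lessThan_add: "(\<Sum>j<k + l. g j) = (\<Sum>j<k. g j) + (\<Sum>j<l. g (k + j))"
  for g :: "nat \<Rightarrow> 'a::comm_monoid_add"
  by (induction l) (simp_all add: add.assoc)

text \<open>The block of length \<open>k\<close> of \<open>v\<close> that starts at index \<open>n\<close>, read as a list of coefficients.\<close>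

definition vec_poly :: "nat \<Rightarrow> nat \<Rightarrow> complex vec \<Rightarrow> complex poly" where
  "vec_poly n k v = (\<Sum>j<k. monom (v $ (n + j)) j)"

lemma coeff_vec_poly: "coeff (vec_poly n k v) j = (if j < k then v $ (n + j) else 0)"
  by (simp add: vec_poly_def coeff_sum)

text \<open>Up to the nonzero factor that dehomogenises the row, the matrix evaluates \<open>p\<^sub>0 + p\<^sub>1 * Y\<close> at the
  \<open>i\<close>-th point.\<close>

lemma interpolation_matrix_mult_vec:
  assumes v: "v \<in> carrier_vec (2 * k)" and i: "i < 2 * k"
    and nz: "w (i, X1) \<noteq> 0" "w (i, Y1) \<noteq> 0"
  shows "(interpolation_matrix k w *\<^sub>v v) $ i = w (i, X1) ^ (k - 1) * w (i, Y1) *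
    (poly (vec_poly 0 k v) (w (i, X0) / w (i, X1)) +
      w (i, Y0) / w (i, Y1) * poly (vec_poly k k v) (w (i, X0) / w (i, X1)))"
proof -
  have pw: "w (i, X0) ^ j * w (i, X1) ^ (k - 1 - j) = w (i, X1) ^ (k - 1) * (w (i, X0) / w (i, X1)) ^ j"
    if "j < k" for j
  proof -
    have "w (i, X1) ^ (k - 1) = w (i, X1) ^ (k - 1 - j) * w (i, X1) ^ j"
      using that by (simp flip: power_add)
    then show ?thesis using nz by (simp add: power_divide)
  qed
  have row1: "(\<Sum>j<k. w (i, X0) ^ j * w (i, X1) ^ (k - 1 - j) * u * v $ (n + j)) =
      w (i, X1) ^ (k - 1) * u * poly (vec_poly n k v) (w (i, X0) / w (i, X1))" for u n
    unfolding vec_poly_def poly_sum poly_monom sum_distrib_left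
    by (intro sum.cong refl) (simp only: pw lessThan_iff, simp only: mult_ac)
  have "(interpolation_matrix k w *\<^sub>v v) $ i = (\<Sum>j<2 * k. interpolation_matrix k w $$ (i, j) * v $ j)"
    using v i interpolation_matrix_carrier[of k w]
    by (simp add: scalar_prod_def atLeast0LessThan)
  also have "\<dots> = (\<Sum>j<k + k. interpolation_matrix k w $$ (i, j) * v $ j)"
    by (simp only: mult_2)
  also have "\<dots> = (\<Sum>j<k. w (i, X0) ^ j * w (i, X1) ^ (k - 1 - j) * w (i, Y1) * v $ (0 + j)) +
      (\<Sum>j<k. w (i, X0) ^ j * w (i, X1) ^ (k - 1 - j) * w (i, Y0) * v $ (k + j))"
    unfolding sum_lessThan_add using i
    by (intro arg_cong2[where f = "(+)"] sum.cong refl) (auto simp: interpolation_matrix_def)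
  finally show ?thesis
    unfolding row1 using nz by (simp add: field_simps)
qed

lemma interpolation_solvable:
  assumes det: "det (interpolation_matrix k w) \<noteq> 0"
    and nz: "\<And>i. i < 2 * k \<Longrightarrow> w (i, X1) \<noteq> 0 \<and> w (i, Y1) \<noteq> 0"
  shows "\<exists>p0 p1. (\<forall>j\<ge>k. coeff p0 j = 0) \<and> (\<forall>j\<ge>k. coeff p1 j = 0) \<and>
    (\<forall>i<2 * k. poly p0 (w (i, X0) / w (i, X1)) +
      w (i, Y0) / w (i, Y1) * poly p1 (w (i, X0) / w (i, X1)) = (r i :: complex))"
proof -
  let ?A = "interpolation_matrix k w"
  note A = interpolation_matrix_carrier[of k w]
  define b where "b = vec (2 * k) (\<lambda>i. w (i, X1) ^ (k - 1) * w (i, Y1) * r i)"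
  have b: "b \<in> carrier_vec (2 * k)" by (simp add: b_def)
  obtain B where B: "B \<in> carrier_mat (2 * k) (2 * k)" "?A * B = 1\<^sub>m (2 * k)"
    using det_non_zero_imp_unit[OF A det, of "()"] by (auto simp: Units_def ring_mat_def)
  define v where "v = B *\<^sub>v b"
  have v: "v \<in> carrier_vec (2 * k)" using B(1) b by (simp add: v_def)
  have Av: "?A *\<^sub>v v = b"
    unfolding v_def assoc_mult_mat_vec[OF A B(1) b, symmetric] B(2) using b by simp
  have "poly (vec_poly 0 k v) (w (i, X0) / w (i, X1)) +
      w (i, Y0) / w (i, Y1) * poly (vec_poly k k v) (w (i, X0) / w (i, X1)) = r i" if "i < 2 * k" for i
    using interpolation_matrix_mult_vec[OF v that, of w] nz[OF that] that
    by (simp add: Av b_def)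
  then show ?thesis
    by (intro exI[of _ "vec_poly 0 k v"] exI[of _ "vec_poly k k v"]) (simp add: coeff_vec_poly)
qed

lemma poly_eq_0_of_many_roots:
  fixes p :: "complex poly"
  assumes "\<And>j. j \<ge> k \<Longrightarrow> coeff p j = 0" "inj_on x {..<k}" "\<And>i. i < k \<Longrightarrow> poly p (x i) = 0"
  shows "p = 0"
proof (rule ccontr)
  assume nz: "p \<noteq> 0"
  have "k = card (x ` {..<k})" using assms(2) by (simp add: card_image)
  also have "\<dots> \<le> card {z. poly p z = 0}"
    using nz assms(3) by (intro card_mono poly_roots_finite) auto
  also have "\<dots> \<le> degree p" by (rule card_poly_roots_bound[OF nz])
  finally have "coeff p (degree p) = 0" by (rule assms(1))
  then show False using nz by simp
qed

text \<open>If the first \<open>k\<close> points lie on \<open>Y0 = 0\<close>, an element of the kernel has \<open>p\<^sub>0 = 0\<close>, because \<open>p\<^sub>0\<close> has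
  \<open>k\<close> roots and degree below \<open>k\<close>; the remaining \<open>k\<close> points then force \<open>p\<^sub>1 = 0\<close>.\<close>

lemma det_interpolation_matrix_nonzero:
  assumes inj: "inj_on (\<lambda>i. w (i, X0)) {..<2 * k}"
    and w: "\<And>i. i < 2 * k \<Longrightarrow> w (i, X1) = 1 \<and> w (i, Y1) = 1 \<and> w (i, Y0) = (if i < k then 0 else 1)"
  shows "det (interpolation_matrix k w) \<noteq> (0 :: complex)"
proof
  assume "det (interpolation_matrix k w) = 0"
  then obtain v where v: "v \<in> carrier_vec (2 * k)" "v \<noteq> 0\<^sub>v (2 * k)"
    and Av: "interpolation_matrix k w *\<^sub>v v = 0\<^sub>v (2 * k)"
    using det_0_iff_vec_prod_zero_field[OF interpolation_matrix_carrier] by blast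
  let ?p = "vec_poly 0 k v" and ?q = "vec_poly k k v"
  have eq: "poly ?p (w (i, X0)) + w (i, Y0) * poly ?q (w (i, X0)) = 0" if "i < 2 * k" for i
    using interpolation_matrix_mult_vec[OF v(1) that, of w] w[OF that] that by (simp add: Av)
  have p: "?p = 0"
  proof (rule poly_eq_0_of_many_roots[of k _ "\<lambda>i. w (i, X0)"])
    show "poly ?p (w (i, X0)) = 0" if "i < k" for i
      using eq[of i] w[of i] that by simp
  qed (use inj in \<open>auto simp: coeff_vec_poly inj_on_def\<close>)
  have q: "?q = 0"
  proof (rule poly_eq_0_of_many_roots[of k _ "\<lambda>i. w (k + i, X0)"])
    show "poly ?q (w (k + i, X0)) = 0" if "i < k" for i
      using eq[of "k + i"] w[of "k + i"] that p by simp
    show "inj_on (\<lambda>i. w (k + i, X0)) {..<k}"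
      using inj_onD[OF inj, of "k + _" "k + _"] by (intro inj_onI) fastforce
  qed (simp add: coeff_vec_poly)
  have "v = 0\<^sub>v (2 * k)"
  proof (rule eq_vecI)
    fix i assume "i < dim_vec (0\<^sub>v (2 * k))"
    then show "v $ i = 0\<^sub>v (2 * k) $ i"
      using arg_cong[OF p, of "\<lambda>p. coeff p i"] arg_cong[OF q, of "\<lambda>p. coeff p (i - k)"]
      by (cases "i < k") (auto simp: coeff_vec_poly split: if_splits)
  qed (use v in simp)
  with v show False by simp
qed

section \<open>The open set of tuples in general position\<close>

text \<open>The three factors are nonzero if and only if all points lie in the affine chart, their first
  coordinates are distinct, and the interpolation problem for the first \<open>2 * (s div 2)\<close> points is
  solvable.\<close>

definition genericity_form :: "nat \<Rightarrow> (nat \<times> coord) cpoly" where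
  "genericity_form s = (\<Prod>i<s. point_var i X1 * point_var i Y1) *
     (\<Prod>i<s. \<Prod>j<i. point_var i X0 * point_var j X1 - point_var j X0 * point_var i X1) *
     det (interpolation_matrix (s div 2) (\<lambda>(i, v). point_var i v))"

lemma multihomogeneous_genericity_form: "multihomogeneous s (genericity_form s)"
  unfolding genericity_form_def
proof (intro multihomogeneous_mult multihomogeneous_prod multihomogeneous_det_interpolation_matrix)
  fix i j assume ij: "i \<in> {..<s}" "j \<in> {..<i}"
  let ?d = "\<lambda>r. (if r = i then 1 else 0) + (if r = j then 1 else 0 :: nat)"
  have a: "multidegree s ?d (\<lambda>r. 0) (point_var i X0 * point_var j X1)"
    using multidegree_mult[OF multidegree_point_var[of i s X0] multidegree_point_var[of j s X1]] ij by simp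
  have b: "multidegree s ?d (\<lambda>r. 0) (point_var j X0 * point_var i X1)"
    using multidegree_mult[OF multidegree_point_var[of i s X1] multidegree_point_var[of j s X0]] ij
    by (simp add: mult.commute)
  show "multihomogeneous s (point_var i X0 * point_var j X1 - point_var j X0 * point_var i X1)"
    using multidegree_add[OF a multidegree_uminus[OF b]] unfolding multihomogeneous_iff by auto
qed (auto simp: multihomogeneous_iff intro: multidegree_point_var)

lemma poly_eval_genericity_form:
  "poly_eval w (genericity_form s) = (\<Prod>i<s. w (i, X1) * w (i, Y1)) *
     (\<Prod>i<s. \<Prod>j<i. w (i, X0) * w (j, X1) - w (j, X0) * w (i, X1)) *
     det (interpolation_matrix (s div 2) w)"
proof -
  interpret ev: comm_ring_hom "poly_eval w" by (rule eval.subst_hom)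
  show ?thesis
    by (simp add: genericity_form_def eval.subst_mult poly_eval_det_interpolation_matrix ev.hom_prod
        ev.hom_minus eval_point_var)
qed

text \<open>A point of the projective line other than infinity has exactly the multiples of its affine
  coordinate vector as homogeneous coordinates.\<close>

lemma hom_coords_scale:
  assumes "u \<in> hom_coords L" "snd u \<noteq> 0"
  shows "hom_coords L = {v. snd v \<noteq> 0 \<and> fst v = fst u / snd u * snd v}"
  using assms
proof (transfer, clarsimp)
  fix L u1 u2 assume *: "proj_eq L L" "proj_eq L (u1, u2)" "u2 \<noteq> 0"
  have "proj_eq L v \<longleftrightarrow> proj_eq (u1, u2) v" for v
    using * proj_eq_sym proj_eq_trans by blast
  moreover have "proj_eq (u1, u2) v \<longleftrightarrow> snd v \<noteq> 0 \<and> fst v = u1 / u2 * snd v" for v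
    unfolding proj_eq_def using *(3)
    by (auto simp: prod_eq_iff intro: exI[of _ "snd v / u2"])
  ultimately show "{v. proj_eq L v} = {v. snd v \<noteq> 0 \<and> fst v = u1 * snd v / u2}"
    by auto
qed

lemma hom_coords_exists: "u \<noteq> (0, 0) \<Longrightarrow> \<exists>L. u \<in> hom_coords L"
proof (transfer fixing: u)
  assume "u \<noteq> (0, 0)"
  then have "proj_eq u u" by (auto simp: proj_eq_def intro: exI[of _ 1])
  then show "\<exists>L\<in>{x. proj_eq x x}. u \<in> {v. proj_eq L v}" by blast
qed

lemma affine_point_of_coords:
  assumes "u \<in> bihom_coords P" "u X1 \<noteq> 0" "u Y1 \<noteq> 0"
  shows "affine_point P (u X0 / u X1) (u Y0 / u Y1)"
  using assms hom_coords_scale[of "(u X0, u X1)" "fst P"] hom_coords_scale[of "(u Y0, u Y1)" "snd P"]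
  by (auto simp: affine_point_def bihom_coords_def)


definition generic_tuples :: "nat \<Rightarrow> biproj list set" where
  "generic_tuples s = {Ps. length Ps = s \<and> (\<exists>w\<in>tuple_coords Ps. poly_eval w (genericity_form s) \<noteq> 0)}"

lemma zariski_open_generic_tuples: "zariski_open s (generic_tuples s)"
proof -
  have "{Ps. length Ps = s} - generic_tuples s =
      {Ps. length Ps = s \<and> (\<forall>f\<in>{genericity_form s}. \<forall>w\<in>tuple_coords Ps. poly_eval w f = 0)}"
    by (auto simp: generic_tuples_def)
  then have "zariski_closed s ({Ps. length Ps = s} - generic_tuples s)"
    unfolding zariski_closed_def using multihomogeneous_genericity_form
    by (intro exI[of _ "{genericity_form s}"]) simp
  then show ?thesis
    by (auto simp: zariski_open_def generic_tuples_def)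
qed

lemma generic_tuples_nonempty: "generic_tuples s \<noteq> {}"
proof -
  \<comment> \<open>Half of the points on one horizontal line and the others on a second one, above distinct abscissas.\<close>
  define w where "w = (\<lambda>(i, v). case v of X0 \<Rightarrow> of_nat i | X1 \<Rightarrow> 1
    | Y0 \<Rightarrow> (if i < s div 2 then 0 else 1) | Y1 \<Rightarrow> (1 :: complex))"
  have "\<forall>i. \<exists>L. (w (i, X0), w (i, X1)) \<in> hom_coords L" "\<forall>i. \<exists>M. (w (i, Y0), w (i, Y1)) \<in> hom_coords M"
    by (simp_all add: w_def hom_coords_exists)
  then obtain L M where LM: "\<And>i. (w (i, X0), w (i, X1)) \<in> hom_coords (L i)"
    "\<And>i. (w (i, Y0), w (i, Y1)) \<in> hom_coords (M i)" by metis
  define Ps where "Ps = map (\<lambda>i. (L i, M i)) [0..<s]"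
  have "w \<in> tuple_coords Ps"
    using LM by (simp add: tuple_coords_def bihom_coords_def Ps_def)
  moreover have "det (interpolation_matrix (s div 2) w) \<noteq> 0"
    by (rule det_interpolation_matrix_nonzero) (auto simp: w_def inj_on_def)
  then have "poly_eval w (genericity_form s) \<noteq> 0"
    unfolding poly_eval_genericity_form by (auto simp: w_def)
  ultimately have "Ps \<in> generic_tuples s"
    by (auto simp: generic_tuples_def Ps_def)
  then show ?thesis by blast
qed

lemma generic_tuple_syzygy_basis:
  assumes "Ps \<in> generic_tuples s"
  shows "\<exists>x y f0 f1 g0 g1. syzygy_basis s (s div 2) (s - s div 2) x y f0 f1 g0 g1 \<and>
    (\<forall>i<s. affine_point (Ps ! i) (x i) (y i))"
proof -
  obtain w where len: "length Ps = s" and w: "w \<in> tuple_coords Ps"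
    and nz: "poly_eval w (genericity_form s) \<noteq> 0"
    using assms by (auto simp: generic_tuples_def)
  define x where "x i = w (i, X0) / w (i, X1)" for i
  define y where "y i = w (i, Y0) / w (i, Y1)" for i
  from nz have aff: "w (i, X1) \<noteq> 0" "w (i, Y1) \<noteq> 0" if "i < s" for i
    using that unfolding poly_eval_genericity_form by auto
  from nz have cross: "w (i, X0) * w (j, X1) \<noteq> w (j, X0) * w (i, X1)" if "j < i" "i < s" for i j
    using that unfolding poly_eval_genericity_form by auto
  from nz have det: "det (interpolation_matrix (s div 2) w) \<noteq> 0"
    unfolding poly_eval_genericity_form by simp
  have "inj_on x {..<s}"
  proof (rule linorder_inj_onI')
    fix j i assume "j \<in> {..<s}" "i \<in> {..<s}" "j < i"
    then show "x j \<noteq> x i"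
      using cross[of j i] aff[of i] aff[of j] by (auto simp: x_def field_simps)
  qed
  then have "\<exists>f0 f1 g0 g1. syzygy_basis s (s div 2) (s - s div 2) x y f0 f1 g0 g1"
    using interpolation_solvable[OF det] aff unfolding x_def y_def
    by (intro balanced_syzygy_basis) auto
  moreover have "affine_point (Ps ! i) (x i) (y i)" if "i < s" for i
    using affine_point_of_coords[of "\<lambda>v. w (i, v)" "Ps ! i"] w aff[OF that] that len
    by (simp add: tuple_coords_def x_def y_def)
  ultimately show ?thesis by blast
qed

section \<open>The Hilbert function of general fat points\<close>

theorem theorem3p10:
  fixes a b m s :: nat
  assumes "b \<le> a" and "b \<le> m" and "2 \<le> m" and "1 \<le> s"
  shows "in_general_position s (\<lambda>Ps.
    ((\<nexists>k c :: nat. s = 2 * k + 1 \<and> c + 2 \<le> b \<and> a = b * k + c + s * (m - b)) \<longrightarrow>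
       hilbert_function (fat_ideal m Ps) a b =
         min (int ((a + 1) * (b + 1)))
             (int s * int ((m + 1) choose 2) - int s * int ((m - b) choose 2))) \<and>
    (\<forall>k c :: nat. s = 2 * k + 1 \<and> c + 2 \<le> b \<and> a = b * k + c + s * (m - b) \<longrightarrow>
       hilbert_function (fat_ideal m Ps) a b =
         int ((a + 1) * (b + 1)) - int ((c + 2) choose 2)))"
  unfolding in_general_position_def
proof (intro exI conjI ballI)
  show "zariski_open s (generic_tuples s)" by (rule zariski_open_generic_tuples)
  show "generic_tuples s \<noteq> {}" by (rule generic_tuples_nonempty)
next
  fix Ps assume Ps: "Ps \<in> generic_tuples s"
  then obtain x y f0 f1 g0 g1
    where "syzygy_basis s (s div 2) (s - s div 2) x y f0 f1 g0 g1"
      and pts: "\<And>i. i < s \<Longrightarrow> affine_point (Ps ! i) (x i) (y i)"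
    using generic_tuple_syzygy_basis by blast
  then interpret syzygy_basis s "s div 2" "s - s div 2" x y f0 f1 g0 g1 by simp
  have "length Ps = s" using Ps by (simp add: generic_tuples_def)
  then have dim: "poly_vs.dim (fat_ideal m Ps \<inter> bihom_part a b) =
      (\<Sum>j\<le>b. a + j * (s - s div 2) + (b - j) * (s div 2) + 1 - s * m)"
    using pts by (rule dim_fat_ideal_part[OF \<open>b \<le> m\<close>])
  note hilbert_value = hilbert_function_value[OF \<open>b \<le> m\<close> dim]
  show "(\<nexists>k c :: nat. s = 2 * k + 1 \<and> c + 2 \<le> b \<and> a = b * k + c + s * (m - b)) \<longrightarrow>
       hilbert_function (fat_ideal m Ps) a b =
         min (int ((a + 1) * (b + 1)))
             (int s * int ((m + 1) choose 2) - int s * int ((m - b) choose 2))"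
    unfolding hilbert_function_eq by (rule conjunct1[OF hilbert_value])
  show "\<forall>k c :: nat. s = 2 * k + 1 \<and> c + 2 \<le> b \<and> a = b * k + c + s * (m - b) \<longrightarrow>
       hilbert_function (fat_ideal m Ps) a b =
         int ((a + 1) * (b + 1)) - int ((c + 2) choose 2)"
  proof (intro allI impI)
    fix k c :: nat assume "s = 2 * k + 1 \<and> c + 2 \<le> b \<and> a = b * k + c + s * (m - b)"
    then have "poly_vs.dim (fat_ideal m Ps \<inter> bihom_part a b) = (c + 2) choose 2"
      by (rule conjunct2[OF hilbert_value, THEN spec, THEN spec, THEN mp])
    then show "hilbert_function (fat_ideal m Ps) a b = int ((a + 1) * (b + 1)) - int ((c + 2) choose 2)"
      by (simp only: hilbert_function_eq)
  qed
qed

end
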